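(* Let $a,b,c,d,p,q\in\mathbb{R}$. Then the invariance equation \[ G_{p,q}\big(G_{a,b}(x,y),G_{c,d}(x,y)\big)=G_{p,q}(x,y)\qquad\text{for all } x,y\in\mathbb{R}_+ \] is satisfied if and only if at least one of the following possibilities holds: (i) $a+b=c+d=p+q=0$ (so all three means are equal to the geometric mean); (ii) $\{a,b\}=\{c,d\}=\{p,q\}$ (so all three means are equal to each other); (iii) $\{a,b\}=\{-c,-d\}$ and $p+q=0$ (so $G_{p,q}$ is the geometric mean and $G_{a,b}=G_{-c,-d}$); (iv) there exist $u,v\in\mathbb{R}$ such that $\{a,b\}=\{u+v,v\}$, $\{c,d\}=\{u-v,-v\}$, and $\{p,q\}=\{u,0\}$ (in this case, $G_{p,q}$ is a power mean); (v) there exists $w\in\mathbb{R}$ such that $\{a,b\}=\{3w,w\}$, $c+d=0$, and $\{p,q\}=\{2w,0\}$ (in this case, $G_{p,q}$ is a power mean and $G_{c,d}$ is the geometric mean); (vi) there exists $w\in\mathbb{R}$ such that $a+b=0$, $\{c,d\}=\{3w,w\}$, and $\{p,q\}=\{2w,0\}$ (in this case, $G_{p,q}$ is a power mean and $G_{a,b}$ is the geometric mean).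
   Context: $\mathbb{R}_+$ denotes the set of positive real numbers. For $p,q\in\mathbb{R}$, the two-variable Gini mean $G_{p,q}:\mathbb{R}_+^2\to\mathbb{R}_+$ is defined for $x,y\in\mathbb{R}_+$ by \[ G_{p,q}(x,y)=\left(\frac{x^p+y^p}{x^q+y^q}\right)^{\frac{1}{p-q}}\ \text{ if } p\neq q,\qquad G_{p,q}(x,y)=\exp\left(\frac{x^p\ln x+y^p\ln y}{x^p+y^p}\right)\ \text{ if } p=q. \] The geometric mean is $(x,y)\mapsto\sqrt{xy}$. The power (Hölder) mean of exponent $p$ is $G_{p,0}$. Braces such as $\{a,b\}$ denote the (unordered) set with elements $a$ and $b$, where $a=b$ is allowed. *)

theory Defs
  imports Complex_Main
begin

text \<open>Means are functions on pairs of positive reals; values at other arguments are irrelevant,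
  and equality of means is equality on positive arguments.\<close>

definition gini_mean :: "real \<Rightarrow> real \<Rightarrow> real \<Rightarrow> real \<Rightarrow> real" where
  "gini_mean p q x y =
    (if p \<noteq> q then ((x powr p + y powr p) / (x powr q + y powr q)) powr (1 / (p - q))
     else exp ((x powr p * ln x + y powr p * ln y) / (x powr p + y powr p)))"

definition geometric_mean :: "real \<Rightarrow> real \<Rightarrow> real" where
  "geometric_mean x y = sqrt (x * y)"

definition power_mean :: "real \<Rightarrow> real \<Rightarrow> real \<Rightarrow> real" where
  "power_mean r = gini_mean r 0"

definition mean_eq :: "(real \<Rightarrow> real \<Rightarrow> real) \<Rightarrow> (real \<Rightarrow> real \<Rightarrow> real) \<Rightarrow> bool" where
  "mean_eq M N \<longleftrightarrow> (\<forall>x>0. \<forall>y>0. M x y = N x y)"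

lemma gini_mean_pos:
  assumes "x > 0" and "y > 0"
  shows "gini_mean p q x y > 0"
proof -
  have "0 < x powr r + y powr r" for r
    using assms by (simp add: add_pos_pos)
  then have "0 < (x powr p + y powr p) / (x powr q + y powr q)"
    by (simp add: divide_pos_pos)
  then show ?thesis
    unfolding gini_mean_def by auto
qed

end

theory Submission
  imports Defs "HOL-Real_Asymp.Real_Asymp"
begin

text \<open>
  Put \<open>x = exp (m + t)\<close> and \<open>y = exp (m - t)\<close>. Then the Gini mean of \<open>x\<close> and \<open>y\<close> is
  \<open>exp (m + log_gini p q t)\<close>, and invariance becomes a functional equation in the single
  variable \<open>t\<close>. Its quadratic term at \<open>t = 0\<close> gives \<open>a + b + c + d = 2 (p + q)\<close>; all further
  information is read off as \<open>t\<close> tends to infinity. There \<open>log_gini p q t\<close> is linear, with slope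
  in \<open>[-1, 1]\<close> determined by the signs and the ratio of \<open>p\<close> and \<open>q\<close>, up to a convergent
  remainder that is explicit in the terms \<open>exp (- 2 \<bar>p\<bar> t)\<close> and \<open>exp (- 2 \<bar>q\<bar> t)\<close>.
  The three slopes satisfy an algebraic relation, and in each of the cases it leaves, the slowest
  decaying exponentials of the two sides have to cancel. This fixes the parameters, in some cases
  only after the next slowest exponentials are compared as well.
\<close>

text \<open>Asymptotics at infinity are used because further Taylor coefficients at 0 give
  polynomial equations of growing degree in six unknowns, whereas exponents can be compared by size.
  They are readable because \<open>ln (cosh x)\<close> is \<open>\<bar>x\<bar> - ln 2\<close> plus a
  logarithm of \<open>1 + exp (- 2 * \<bar>x\<bar>)\<close>, and the logarithm of a Gini mean is a
  divided difference of such terms. Two degenerate parameter choices shape the bookkeeping: equal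
  parameters produce a factor \<open>t\<close> in front of the exponential, and a vanishing
  parameter leaves a nonzero limit of the remainder. The power means \<open>q = 0\<close> are where
  the nontrivial solutions live; there the equation is exponentiated, since it then becomes a plain
  sum. The family with two free parameters explains the second-order expansions: leading terms
  already agree on a set larger than the set of solutions. Where two of the slopes are 1 and
  \<open>q > 0\<close>, monotonicity of the remainder can replace the matching of
  coefficients.\<close>

section \<open>Gini means in logarithmic coordinates\<close>

definition log_gini :: "real \<Rightarrow> real \<Rightarrow> real \<Rightarrow> real" where
  "log_gini p q t =
    (if p = q then t * tanh (p * t) else (ln (cosh (p * t)) - ln (cosh (q * t))) / (p - q))"

lemma gini_mean_exp:
  "gini_mean p q (exp (m + t)) (exp (m - t)) = exp (m + log_gini p q t)"
proof -
  have *: "exp (m + t) powr r + exp (m - t) powr r = exp (r * m) * (2 * cosh (r * t))" for r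
    by (simp add: powr_def cosh_def algebra_simps flip: exp_add)
  show ?thesis
  proof (cases "p = q")
    case True
    have "exp (m + t) powr p * (m + t) + exp (m - t) powr p * (m - t)
        = exp (p * m) * (2 * cosh (p * t)) * m + exp (p * m) * (2 * sinh (p * t)) * t"
      by (simp add: powr_def cosh_def sinh_def algebra_simps flip: exp_add)
    then have "(exp (m + t) powr p * (m + t) + exp (m - t) powr p * (m - t)) /
        (exp (m + t) powr p + exp (m - t) powr p) = m + t * tanh (p * t)"
      unfolding * by (simp add: tanh_def field_simps)
    with True show ?thesis by (simp add: gini_mean_def log_gini_def)
  next
    case False
    have "exp (p * m) * (2 * cosh (p * t)) / (exp (q * m) * (2 * cosh (q * t)))
        = exp ((p - q) * m + (ln (cosh (p * t)) - ln (cosh (q * t))))"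
      by (simp add: exp_add exp_diff field_simps)
    with False show ?thesis
      by (simp add: gini_mean_def log_gini_def *) (simp add: powr_def add_divide_distrib)
  qed
qed

lemma pos_pair_exp:
  fixes x y :: real
  assumes "x > 0" "y > 0"
  obtains m t where "x = exp (m + t)" "y = exp (m - t)"
proof
  show "x = exp ((ln x + ln y) / 2 + (ln x - ln y) / 2)" "y = exp ((ln x + ln y) / 2 - (ln x - ln y) / 2)"
    using assms by (simp_all add: field_simps flip: ln_div)
qed

lemma log_gini_commute: "log_gini p q t = log_gini q p t"
  unfolding log_gini_def by (metis minus_diff_eq minus_divide_divide)

lemma log_gini_minus: "log_gini (- p) (- q) t = - log_gini p q t"
proof -
  have "x / (- p - - q) = - (x / (p - q))" for x
    using minus_divide_right[of x "p - q"] by simp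
  then show ?thesis by (simp add: log_gini_def del: minus_diff_eq minus_diff_minus)
qed

lemma log_gini_even: "log_gini p q (- t) = log_gini p q t"
  by (simp add: log_gini_def)

lemma log_gini_at_0 [simp]: "log_gini p q 0 = 0"
  by (simp add: log_gini_def)

lemma log_gini_opposite: "p + q = 0 \<Longrightarrow> log_gini p q t = 0"
  by (auto simp: log_gini_def eq_neg_iff_add_eq_0[symmetric])

text \<open>\<open>log_gini p q t\<close> is the divided difference of
  \<open>r \<mapsto> ln (cosh (r * t))\<close>, and the diagonal clause is its derivative, so the
  mean value theorem covers all cases. This yields the bound by \<open>\<bar>t\<bar>\<close> and the
  sign.\<close>

lemma log_gini_mvt: "\<exists>r. min p q \<le> r \<and> r \<le> max p q \<and> log_gini p q t = t * tanh (r * t)"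
proof -
  have *: "\<exists>r. q \<le> r \<and> r \<le> p \<and> log_gini p q t = t * tanh (r * t)" if "q < p" for p q
  proof -
    have "((\<lambda>r. ln (cosh (r * t))) has_real_derivative t * tanh (r * t)) (at r)" for r
      by (auto intro!: derivative_eq_intros simp: tanh_def)
    from MVT2[OF that this] obtain r where "q < r" "r < p"
      "ln (cosh (p * t)) - ln (cosh (q * t)) = (p - q) * (t * tanh (r * t))" by blast
    with that show ?thesis by (intro exI[of _ r]) (auto simp: log_gini_def)
  qed
  consider "q < p" | "p < q" | "p = q" by linarith
  then show ?thesis
  proof cases
    case 1 then show ?thesis using *[OF 1] by (simp add: min_def max_def)
  next
    case 2 then show ?thesis using *[OF 2] by (simp add: min_def max_def log_gini_commute[of p])
  next
    case 3 then show ?thesis by (intro exI[of _ p]) (simp add: log_gini_def)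
  qed
qed

lemma abs_log_gini_less: assumes "t \<noteq> 0" shows "\<bar>log_gini p q t\<bar> < \<bar>t\<bar>"
proof -
  obtain r where r: "log_gini p q t = t * tanh (r * t)" using log_gini_mvt by blast
  have "\<bar>tanh (r * t)\<bar> < 1" using tanh_real_bounds[of "r * t"] by auto
  then show ?thesis using assms by (simp add: r abs_mult)
qed

lemma abs_log_gini_le: "\<bar>log_gini p q t\<bar> \<le> \<bar>t\<bar>"
  using abs_log_gini_less[of t p q] by (cases "t = 0") auto

lemma log_gini_nonneg: assumes "0 \<le> p" "0 \<le> q" shows "0 \<le> log_gini p q t"
proof -
  obtain r where r: "min p q \<le> r" "log_gini p q t = t * tanh (r * t)" using log_gini_mvt by blast
  with assms have "r \<ge> 0" by auto
  then show ?thesis by (cases "t \<ge> 0") (auto simp: r zero_le_mult_iff mult_nonneg_nonpos)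
qed

text \<open>To leading order \<open>ln (cosh (r * t))\<close> is \<open>r ^ 2 * t ^ 2 / 2\<close>,
  and the divided difference of \<open>r ^ 2 / 2\<close> is \<open>(p + q) / 2\<close>.\<close>

lemma log_gini_quadratic: "((\<lambda>t. log_gini p q t / t ^ 2) \<longlongrightarrow> (p + q) / 2) (at 0)"
proof -
  have c: "((\<lambda>t. ln (cosh (r * t)) / t ^ 2) \<longlongrightarrow> r ^ 2 / 2) (at 0)" for r :: real
    unfolding cosh_field_def power2_eq_square by real_asymp
  show ?thesis
  proof (cases "p = q")
    case True
    have "((\<lambda>t. t * tanh (p * t) / t ^ 2) \<longlongrightarrow> p) (at 0)"
      unfolding tanh_def cosh_field_def sinh_field_def by real_asymp
    with True show ?thesis by (simp add: log_gini_def)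
  next
    case False
    have "((\<lambda>t. (ln (cosh (p * t)) / t ^ 2 - ln (cosh (q * t)) / t ^ 2) / (p - q))
        \<longlongrightarrow> (p ^ 2 / 2 - q ^ 2 / 2) / (p - q)) (at 0)"
      using False by (intro tendsto_intros c) auto
    moreover have "(p ^ 2 / 2 - q ^ 2 / 2) / (p - q) = (p + q) / 2"
      using False by (simp add: field_simps power2_eq_square)
    moreover have "(ln (cosh (p * t)) / t ^ 2 - ln (cosh (q * t)) / t ^ 2) / (p - q) = log_gini p q t / t ^ 2" for t
      using False by (simp add: log_gini_def diff_divide_distrib divide_divide_eq_left mult.commute)
    ultimately show ?thesis by simp
  qed
qed

section \<open>The functional equation in one variable and its symmetries\<close>

definition log_invariant where
  "log_invariant a b c d p q \<longleftrightarrow> (\<forall>t. (log_gini a b t + log_gini c d t) / 2 +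
     log_gini p q ((log_gini a b t - log_gini c d t) / 2) = log_gini p q t)"

text \<open>The two inner means have logarithms \<open>m + A\<close> and \<open>m + C\<close>, so
  they form a pair of the same shape with midpoint \<open>m + (A + C) / 2\<close> and half-distance
  \<open>(A - C) / 2\<close>. By homogeneity \<open>m\<close> cancels.\<close>

lemma invariance_iff:
  "(\<forall>x>0. \<forall>y>0. gini_mean p q (gini_mean a b x y) (gini_mean c d x y) = gini_mean p q x y)
   \<longleftrightarrow> log_invariant a b c d p q"
proof -
  have *: "gini_mean p q (gini_mean a b (exp (m + t)) (exp (m - t)))
         (gini_mean c d (exp (m + t)) (exp (m - t))) = gini_mean p q (exp (m + t)) (exp (m - t))
     \<longleftrightarrow> (log_gini a b t + log_gini c d t) / 2 +
       log_gini p q ((log_gini a b t - log_gini c d t) / 2) = log_gini p q t" for m t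
  proof -
    let ?A = "log_gini a b t" and ?C = "log_gini c d t"
    have 1: "m + ?A = (m + (?A + ?C) / 2) + (?A - ?C) / 2"
            "m + ?C = (m + (?A + ?C) / 2) - (?A - ?C) / 2" by (auto simp: field_simps)
    have "gini_mean p q (exp (m + ?A)) (exp (m + ?C)) =
       exp ((m + (?A + ?C) / 2) + log_gini p q ((?A - ?C) / 2))"
      using gini_mean_exp[of p q "m + (?A + ?C) / 2" "(?A - ?C) / 2"] unfolding 1[symmetric] .
    then show ?thesis by (simp add: gini_mean_exp add.assoc)
  qed
  show ?thesis
    unfolding log_invariant_def
  proof (intro iffI allI impI)
    fix t assume "\<forall>x>0. \<forall>y>0. gini_mean p q (gini_mean a b x y) (gini_mean c d x y) = gini_mean p q x y"
    then show "(log_gini a b t + log_gini c d t) / 2 +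
       log_gini p q ((log_gini a b t - log_gini c d t) / 2) = log_gini p q t"
      using *[of 0 t] by simp
  next
    fix x y :: real assume H: "\<forall>t. (log_gini a b t + log_gini c d t) / 2 +
       log_gini p q ((log_gini a b t - log_gini c d t) / 2) = log_gini p q t" and "x > 0" "y > 0"
    then obtain m t where "x = exp (m + t)" "y = exp (m - t)" using pos_pair_exp by blast
    with H show "gini_mean p q (gini_mean a b x y) (gini_mean c d x y) = gini_mean p q x y"
      using * by simp
  qed
qed

lemma log_invariantD:
  "log_invariant a b c d p q \<Longrightarrow> (log_gini a b t + log_gini c d t) / 2 +
     log_gini p q ((log_gini a b t - log_gini c d t) / 2) = log_gini p q t"
  by (simp add: log_invariant_def)

lemma log_invariant_swap: "log_invariant a b c d p q \<Longrightarrow> log_invariant c d a b p q"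
  unfolding log_invariant_def
  by (metis add.commute log_gini_even minus_diff_eq minus_divide_left)

text \<open>The duality behind this is that the mean with negated parameters is the reciprocal of
  the mean of the reciprocals. It later reduces a negative \<open>slope p q\<close> to a positive
  one.\<close>

lemma log_invariant_minus:
  assumes "log_invariant a b c d p q"
  shows "log_invariant (- a) (- b) (- c) (- d) (- p) (- q)"
  unfolding log_invariant_def log_gini_minus
proof
  fix t
  have "log_gini p q ((- log_gini a b t - - log_gini c d t) / 2)
      = log_gini p q ((log_gini a b t - log_gini c d t) / 2)"
    using log_gini_even[of p q "(log_gini a b t - log_gini c d t) / 2"] by (simp add: minus_divide_left)
  then show "(- log_gini a b t + - log_gini c d t) / 2
     + - log_gini p q ((- log_gini a b t - - log_gini c d t) / 2) = - log_gini p q t"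
    using log_invariantD[OF assms, of t] by (simp add: field_simps)
qed

lemma log_invariant_commute:
  "log_invariant b a c d p q = log_invariant a b c d p q"
  "log_invariant a b d c p q = log_invariant a b c d p q"
  "log_invariant a b c d q p = log_invariant a b c d p q"
  by (simp_all add: log_invariant_def log_gini_commute[of b a] log_gini_commute[of d c] log_gini_commute[of q p])

text \<open>For a power mean, invariance means that the two inner means have the same sum of
  \<open>p\<close>-th powers as \<open>x\<close> and \<open>y\<close>.\<close>

lemma log_invariant_power_iff:
  assumes "p \<noteq> 0"
  shows "log_invariant a b c d p 0 \<longleftrightarrow>
    (\<forall>t. exp (p * log_gini a b t) + exp (p * log_gini c d t) = 2 * cosh (p * t))"
proof -
  have "(A + C) / 2 + log_gini p 0 ((A - C) / 2) = log_gini p 0 t \<longleftrightarrow>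
    exp (p * A) + exp (p * C) = 2 * cosh (p * t)" for A C t
  proof -
    have "(A + C) / 2 + log_gini p 0 ((A - C) / 2) = log_gini p 0 t \<longleftrightarrow>
      p * (A + C) / 2 + ln (cosh (p * (A - C) / 2)) = ln (cosh (p * t))"
    proof -
      have "(A + C) / 2 + log_gini p 0 ((A - C) / 2) = log_gini p 0 t \<longleftrightarrow>
        p * ((A + C) / 2 + log_gini p 0 ((A - C) / 2)) = p * log_gini p 0 t"
        using assms by simp
      then show ?thesis using assms by (simp add: log_gini_def distrib_left)
    qed
    also have "\<dots> \<longleftrightarrow> exp (p * (A + C) / 2 + ln (cosh (p * (A - C) / 2))) = exp (ln (cosh (p * t)))"
      by (subst exp_inj_iff) simp
    also have "\<dots> \<longleftrightarrow> exp (p * (A + C) / 2) * (2 * cosh (p * (A - C) / 2)) = 2 * cosh (p * t)"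
      by (simp add: exp_add)
    also have "exp (p * (A + C) / 2) * (2 * cosh (p * (A - C) / 2)) = exp (p * A) + exp (p * C)"
      by (simp add: cosh_def distrib_left flip: exp_add) (simp add: field_simps)
    finally show ?thesis .
  qed
  then show ?thesis unfolding log_invariant_def by simp
qed

subsection \<open>Leading terms at infinity\<close>

text \<open>\<open>lead f m j c\<close> means \<open>f(t) = (c + o(1)) t\<^sup>j e\<^sup>-\<^sup>2\<^sup>m\<^sup>t\<close>; here \<open>c = 0\<close> is allowed.\<close>

definition lead :: "(real \<Rightarrow> real) \<Rightarrow> real \<Rightarrow> nat \<Rightarrow> real \<Rightarrow> bool" where
  "lead f m j c \<longleftrightarrow> ((\<lambda>t. f t * exp (2 * m * t) / t ^ j) \<longlongrightarrow> c) at_top"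

lemma lead_cong:
  assumes "eventually (\<lambda>t. f t = h t) at_top" "lead f m j c"
  shows "lead h m j c"
  using assms(2) unfolding lead_def
  by (rule Lim_transform_eventually) (use assms(1) in eventually_elim, simp)

lemma lead_add: "lead f m j c \<Longrightarrow> lead h m j d \<Longrightarrow> lead (\<lambda>t. f t + h t) m j (c + d)"
  unfolding lead_def by (simp add: add_divide_distrib distrib_right tendsto_add)

lemma lead_diff: "lead f m j c \<Longrightarrow> lead h m j d \<Longrightarrow> lead (\<lambda>t. f t - h t) m j (c - d)"
  unfolding lead_def by (simp add: diff_divide_distrib left_diff_distrib tendsto_diff)

lemma lead_minus: "lead f m j c \<Longrightarrow> lead (\<lambda>t. - f t) m j (- c)"
  unfolding lead_def by (simp add: tendsto_minus)

lemma lead_cmult: "lead f m j c \<Longrightarrow> lead (\<lambda>t. r * f t) m j (r * c)"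
  unfolding lead_def by (drule tendsto_mult_left[of _ c _ r]) (simp add: mult.assoc)

lemma lead_divide: "lead f m j c \<Longrightarrow> lead (\<lambda>t. f t / r) m j (c / r)"
  using lead_cmult[of f m j c "1 / r"] by simp

lemma lead_mult:
  assumes "lead f m i c" "lead h n j d"
  shows "lead (\<lambda>t. f t * h t) (m + n) (i + j) (c * d)"
  using tendsto_mult[OF assms[unfolded lead_def]] unfolding lead_def
  by (simp add: exp_add power_add algebra_simps)

lemma lead_zero: "lead (\<lambda>t. 0) m j 0"
  by (simp add: lead_def)

lemma lead_unique: "lead f m j c \<Longrightarrow> lead f m j d \<Longrightarrow> c = d"
  unfolding lead_def by (rule tendsto_unique) auto

lemma lead_eq_0:
  assumes "lead f m j c" "eventually (\<lambda>t. f t = 0) at_top"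
  shows "c = 0"
  using lead_cong[OF assms(2,1)] lead_zero by (rule lead_unique)

lemma lead_nonneg:
  assumes "lead f m j c" "eventually (\<lambda>t. f t \<ge> 0) at_top"
  shows "c \<ge> 0"
  using assms(1) unfolding lead_def
proof (rule tendsto_lowerbound)
  show "eventually (\<lambda>t. f t * exp (2 * m * t) / t ^ j \<ge> 0) at_top"
    using assms(2) eventually_ge_at_top[of 0] by eventually_elim simp
qed simp

lemma lead_nonpos:
  assumes "lead f m j c" "eventually (\<lambda>t. f t \<le> 0) at_top"
  shows "c \<le> 0"
  using lead_nonneg[OF lead_minus[OF assms(1)]] assms(2) by simp

text \<open>A gap between the exponents absorbs every power of \<open>t\<close>, so \<open>i\<close>
  and \<open>j\<close> are unrelated. This is the standard way to declare a term negligible on a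
  coarser scale.\<close>

lemma lead_faster:
  assumes "lead f m j c" "n < m"
  shows "lead f n i 0"
proof -
  have "((\<lambda>t. (2 * (m - n) * t) ^ j / exp (2 * (m - n) * t) / (2 * (m - n)) ^ j) \<longlongrightarrow> 0 / (2 * (m - n)) ^ j) at_top"
    using assms(2)
    by (intro tendsto_divide tendsto_const filterlim_compose[OF tendsto_power_div_exp_0]) (simp, real_asymp, simp)
  then have 1: "((\<lambda>t. t ^ j / exp (2 * (m - n) * t)) \<longlongrightarrow> 0) at_top"
    using assms(2) by (simp add: power_mult_distrib)
  have "((\<lambda>t. t ^ j / exp (2 * (m - n) * t) / t ^ i) \<longlongrightarrow> 0) at_top"
  proof (rule tendsto_sandwich[OF _ _ tendsto_const 1])
    show "eventually (\<lambda>t. 0 \<le> t ^ j / exp (2 * (m - n) * t) / t ^ i) at_top"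
      using eventually_ge_at_top[of 1] by eventually_elim simp
    show "eventually (\<lambda>t. t ^ j / exp (2 * (m - n) * t) / t ^ i \<le> t ^ j / exp (2 * (m - n) * t)) at_top"
      using eventually_ge_at_top[of 1]
    proof eventually_elim
      case (elim t)
      then have "t ^ i \<ge> 1" by simp
      then show ?case using elim
        divide_left_mono[of 1 "t ^ i" "t ^ j / exp (2 * (m - n) * t)"] by simp
    qed
  qed
  from tendsto_mult[OF assms(1)[unfolded lead_def] this]
  have "((\<lambda>t. f t * exp (2 * m * t) / t ^ j * (t ^ j / exp (2 * (m - n) * t) / t ^ i)) \<longlongrightarrow> 0) at_top" by simp
  then show ?thesis unfolding lead_def
  proof (rule Lim_transform_eventually)
    show "eventually (\<lambda>t. f t * exp (2 * m * t) / t ^ j * (t ^ j / exp (2 * (m - n) * t) / t ^ i)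
        = f t * exp (2 * n * t) / t ^ i) at_top"
      using eventually_ge_at_top[of 1]
    proof eventually_elim
      case (elim t)
      have "exp (2 * m * t) = exp (2 * n * t) * exp (2 * (m - n) * t)"
        by (simp add: algebra_simps flip: exp_add)
      then show ?case using elim by simp
    qed
  qed
qed

lemma lead_Suc:
  assumes "lead f m j c" shows "lead f m (Suc j) 0"
proof -
  have "((\<lambda>t. f t * exp (2 * m * t) / t ^ j * (1 / t)) \<longlongrightarrow> c * 0) at_top"
    using assms unfolding lead_def by (intro tendsto_mult) (simp, real_asymp)
  then show ?thesis by (simp add: lead_def mult.commute)
qed

lemma lead_tendsto:
  assumes "lead f m j c" "m > 0" shows "(f \<longlongrightarrow> 0) at_top"
  using lead_faster[OF assms, of 0] by (simp add: lead_def)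

lemma tendsto_leadD: "(f \<longlongrightarrow> c) at_top \<Longrightarrow> lead f 0 0 c"
  by (simp add: lead_def)

lemma lead_exp: "lead (\<lambda>t. exp (- (2 * m * t))) m 0 1"
  by (simp add: lead_def flip: exp_add)

text \<open>A function that vanishes to order \<open>n\<close> at 0 multiplies the exponent by
  \<open>n\<close>. The expansions of logarithm, exponential and \<open>log_gini\<close> are
  instances; second-order ones arise by subtracting the linear part of \<open>h\<close>
  first.\<close>

lemma lead_comp:
  assumes "lead f m j c" "m > 0" and h: "((\<lambda>x. h x / x ^ n) \<longlongrightarrow> L) (at 0)" and h0: "h 0 = 0" "n > 0"
  shows "lead (\<lambda>t. h (f t)) (real n * m) (n * j) (L * c ^ n)"
proof -
  \<comment> \<open>The value at 0 makes \<open>\<rho>\<close> continuous there; \<open>f t\<close>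
    may be 0 for arbitrarily large \<open>t\<close>, where the quotient would be
    \<open>0 / 0\<close>.\<close>
  define \<rho> where "\<rho> x = (if x = 0 then L else h x / x ^ n)" for x
  have "(\<rho> \<longlongrightarrow> \<rho> 0) (at 0)"
  proof -
    have "(\<rho> \<longlongrightarrow> L) (at 0)"
      by (rule Lim_transform_eventually[OF h]) (auto simp: eventually_at_filter \<rho>_def)
    then show ?thesis by (simp add: \<rho>_def)
  qed
  then have "isCont \<rho> 0" by (simp add: isCont_def)
  then have "((\<lambda>t. \<rho> (f t)) \<longlongrightarrow> \<rho> 0) at_top"
    using lead_tendsto[OF assms(1,2)] by (rule isCont_tendsto_compose)
  then have "((\<lambda>t. \<rho> (f t) * (f t * exp (2 * m * t) / t ^ j) ^ n) \<longlongrightarrow> L * c ^ n) at_top"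
    using assms(1) unfolding lead_def by (intro tendsto_mult tendsto_power) (auto simp: \<rho>_def)
  moreover have "\<rho> x * x ^ n = h x" for x using h0 by (auto simp: \<rho>_def)
  then have "\<rho> (f t) * (f t * exp (2 * m * t) / t ^ j) ^ n = h (f t) * exp (2 * (real n * m) * t) / t ^ (n * j)" for t
    by (simp add: power_mult_distrib power_divide flip: exp_of_nat_mult power_mult) (simp add: mult_ac)
  ultimately show ?thesis unfolding lead_def by simp
qed

lemma lead_ln1p: "lead f m j c \<Longrightarrow> m > 0 \<Longrightarrow> lead (\<lambda>t. ln (1 + f t)) m j c"
proof -
  assume *: "lead f m j c" "m > 0"
  have "((\<lambda>x::real. ln (1 + x) / x ^ 1) \<longlongrightarrow> 1) (at 0)" by real_asymp
  from lead_comp[OF * this] show ?thesis by simp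
qed

lemma lead_expm1: "lead f m j c \<Longrightarrow> m > 0 \<Longrightarrow> lead (\<lambda>t. exp (f t) - 1) m j c"
proof -
  assume *: "lead f m j c" "m > 0"
  have "((\<lambda>x::real. (exp x - 1) / x ^ 1) \<longlongrightarrow> 1) (at 0)" by real_asymp
  from lead_comp[OF * this] show ?thesis by simp
qed

lemma lead_expm1_2:
  assumes "lead f m j c" "m > 0"
  shows "lead (\<lambda>t. exp (f t) - 1 - f t) (2 * m) (2 * j) (c ^ 2 / 2)"
proof -
  have "((\<lambda>x::real. (exp x - 1 - x) / x ^ 2) \<longlongrightarrow> 1 / 2) (at 0)" by real_asymp
  from lead_comp[OF assms this] show ?thesis by simp
qed

lemma lead_ln1p_2:
  assumes "lead f m j c" "m > 0"
  shows "lead (\<lambda>t. ln (1 + f t) - f t) (2 * m) (2 * j) (- (c ^ 2 / 2))"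
proof -
  have "((\<lambda>x::real. (ln (1 + x) - x) / x ^ 2) \<longlongrightarrow> - (1 / 2)) (at 0)" by real_asymp
  from lead_comp[OF assms this] show ?thesis by simp
qed

lemma lead_log_gini:
  assumes "lead f m j c" "m > 0"
  shows "lead (\<lambda>t. log_gini p q (f t)) (2 * m) (2 * j) ((p + q) / 2 * c ^ 2)"
  using lead_comp[OF assms log_gini_quadratic] by simp

section \<open>Slope and remainder of \<open>log_gini\<close> at infinity\<close>

text \<open>The decaying part of \<open>ln (cosh x)\<close>, see \<open>ln_cosh_eq\<close>. Its
  value \<open>ln 2\<close> at 0 is the source of the limit \<open>- (ln 2 / a)\<close> that
  \<open>rem a 0\<close> has.\<close>

definition ell :: "real \<Rightarrow> real" where "ell x = ln (1 + exp (- (2 * x)))"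

lemma ell_0 [simp]: "ell 0 = ln 2" by (simp add: ell_def)

lemma ln_cosh_eq: "ln (cosh x) = \<bar>x\<bar> - ln 2 + ell \<bar>x\<bar>" for x :: real
proof -
  have "ln (cosh x) = x - ln 2 + ell x" for x :: real
  proof -
    have "cosh x = exp (x - ln 2 + ell x)"
      by (simp add: cosh_def ell_def exp_add exp_diff add_pos_pos distrib_left mult_exp_exp)
    then show ?thesis by simp
  qed
  from this[of "\<bar>x\<bar>"] show ?thesis by simp
qed

lemma lead_ell: "m > 0 \<Longrightarrow> lead (\<lambda>t. ell (m * t)) m 0 1"
  unfolding ell_def using lead_ln1p[OF lead_exp[of m]] by (simp add: mult.assoc)

lemma lead_ell_2: "m > 0 \<Longrightarrow> lead (\<lambda>t. ell (m * t) - exp (- (2 * m * t))) (2 * m) 0 (- (1 / 2))"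
  unfolding ell_def using lead_ln1p_2[OF lead_exp[of m]] by (simp add: mult.assoc)

lemma lead_exp_shift:
  assumes "((\<lambda>t. e t) \<longlongrightarrow> \<delta>) at_top"
  shows "lead (\<lambda>t. exp (- (2 * (r * (k * t + e t))))) (r * k) 0 (exp (- (2 * r * \<delta>)))"
proof -
  have "((\<lambda>t. exp (- (2 * r * e t))) \<longlongrightarrow> exp (- (2 * r * \<delta>))) at_top"
    by (intro tendsto_intros assms)
  then show ?thesis unfolding lead_def
    by (simp add: algebra_simps flip: exp_add)
qed

lemma lead_ell_shift:
  assumes "((\<lambda>t. e t) \<longlongrightarrow> \<delta>) at_top" "r > 0" "k > 0"
  shows "lead (\<lambda>t. ell (r * (k * t + e t))) (r * k) 0 (exp (- (2 * r * \<delta>)))"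
  unfolding ell_def using lead_ln1p[OF lead_exp_shift[OF assms(1)]] assms(2,3) by simp

text \<open>With \<open>X = exp (- 2 * r * k * t)\<close> the difference is the logarithm of
  \<open>1 + X / (1 + X) * (exp (- 2 * r * e t) - 1)\<close>. Hence the decay of the shift
  \<open>e\<close> adds to the decay of \<open>X\<close>.\<close>

lemma lead_ell_diff:
  assumes "lead e m j c" "m > 0" "r > 0" "k > 0"
  shows "lead (\<lambda>t. ell (r * (k * t + e t)) - ell (r * k * t)) (r * k + m) j (- (2 * r * c))"
proof -
  let ?X = "\<lambda>t. exp (- (2 * (r * k) * t))"
  have 1: "lead (\<lambda>t. exp (- (2 * r) * e t) - 1) m j (- (2 * r) * c)"
    by (intro lead_expm1 lead_cmult assms)
  have "((\<lambda>t. 1 / (1 + ?X t)) \<longlongrightarrow> 1 / (1 + 0)) at_top"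
    using lead_tendsto[OF lead_exp[of "r * k"]] assms by (intro tendsto_intros) auto
  then have 2: "lead (\<lambda>t. 1 / (1 + ?X t)) 0 0 1" by (simp add: tendsto_leadD)
  have "lead (\<lambda>t. ln (1 + 1 / (1 + ?X t) * (?X t * (exp (- (2 * r) * e t) - 1)))) (r * k + m) j (- (2 * r) * c)"
    using lead_ln1p[OF lead_mult[OF 2 lead_mult[OF lead_exp[of "r * k"] 1]]] assms by (simp add: add_pos_pos)
  moreover have "ln (1 + 1 / (1 + ?X t) * (?X t * (exp (- (2 * r) * e t) - 1)))
    = ell (r * (k * t + e t)) - ell (r * k * t)" for t
  proof -
    have *: "exp (- (2 * (r * (k * t + e t)))) = ?X t * exp (- (2 * r) * e t)"
      by (simp add: algebra_simps flip: exp_add)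
    have **: "1 + ?X t > 0" "1 + ?X t * exp (- (2 * r) * e t) > 0" by (simp_all add: add_pos_pos)
    then have "1 + 1 / (1 + ?X t) * (?X t * (exp (- (2 * r) * e t) - 1))
      = (1 + ?X t * exp (- (2 * r) * e t)) / (1 + ?X t)" by (simp add: field_simps)
    with ** show ?thesis unfolding ell_def * by (simp add: ln_div mult.assoc)
  qed
  ultimately show ?thesis by simp
qed

text \<open>The divided difference of the absolute value, with its derivative \<open>sgn\<close> on
  the diagonal. It is the limit of \<open>log_gini a b t / t\<close>, see
  \<open>log_gini_slope\<close>.\<close>

definition slope :: "real \<Rightarrow> real \<Rightarrow> real" where
  "slope a b = (if a = b then sgn a else (\<bar>a\<bar> - \<bar>b\<bar>) / (a - b))"

definition rem :: "real \<Rightarrow> real \<Rightarrow> real \<Rightarrow> real" where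
  "rem a b t = log_gini a b t - slope a b * t"

lemma log_gini_eq_rem: "log_gini a b t = slope a b * t + rem a b t"
  by (simp add: rem_def)

lemma slope_minus: "slope (- a) (- b) = - slope a b"
proof -
  have "x / (- a - - b) = - (x / (a - b))" for x
    using minus_divide_right[of x "a - b"] by simp
  then show ?thesis by (simp add: slope_def sgn_minus del: minus_diff_eq minus_diff_minus)
qed

lemma slope_commute: "slope a b = slope b a"
  unfolding slope_def by (metis minus_diff_eq minus_divide_divide)

lemma rem_minus: "rem (- a) (- b) t = - rem a b t"
  by (simp add: rem_def log_gini_minus slope_minus)

lemma rem_commute: "rem a b t = rem b a t"
  by (simp add: rem_def log_gini_commute[of a] slope_commute[of a])

lemma slope_eq_1: "0 \<le> b \<Longrightarrow> b \<le> a \<Longrightarrow> 0 < a \<Longrightarrow> slope a b = 1"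
  by (simp add: slope_def)

lemma slope_opposite: "a + b = 0 \<Longrightarrow> slope a b = 0"
  by (auto simp: slope_def eq_neg_iff_add_eq_0[symmetric])

lemma rem_opposite: "a + b = 0 \<Longrightarrow> rem a b t = 0"
  by (simp add: rem_def slope_opposite log_gini_opposite)

lemma slope_mixed: "b < 0 \<Longrightarrow> 0 < a \<Longrightarrow> slope a b = (a + b) / (a - b)"
  by (simp add: slope_def)

lemma slope_cases:
  assumes "b \<le> a"
  obtains "0 \<le> b" "0 < a" "slope a b = 1"
  | "a \<le> 0" "b < 0" "slope a b = - 1"
  | "a + b = 0 \<or> b < 0 \<and> 0 < a" "- 1 < slope a b" "slope a b < 1"
proof -
  consider "0 \<le> b" "0 < a" | "a \<le> 0" "b < 0" | "a + b = 0" | "b < 0" "0 < a"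
    using assms by linarith
  then show thesis
  proof cases
    case 1 then show ?thesis using that(1) slope_eq_1 assms by simp
  next
    case 2 then show ?thesis using that(2) slope_eq_1[of "- a" "- b"] slope_minus[of a b] slope_commute[of "- b"] assms by simp
  next
    case 3 then show ?thesis using that(3) slope_opposite[OF 3] by simp
  next
    case 4 then show ?thesis using that(3) slope_mixed[OF 4] by (simp add: field_simps)
  qed
qed

lemma rem_eq_ell:
  assumes "a \<noteq> b" "t \<ge> 0"
  shows "rem a b t = (ell (\<bar>a\<bar> * t) - ell (\<bar>b\<bar> * t)) / (a - b)"
  using assms by (simp add: rem_def log_gini_def slope_def ln_cosh_eq abs_mult diff_divide_distrib
      add_divide_distrib left_diff_distrib)

lemma rem_diag: "a > 0 \<Longrightarrow> rem a a t = - (2 * t) / (1 + exp (2 * a * t))"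
proof -
  assume "a > 0"
  have *: "(y - inverse y) / (y + inverse y) - 1 = - 2 / (1 + y * y)" if "y > 0" for y :: real
  proof -
    have "y - inverse y = (y * y - 1) / y" "y + inverse y = (1 + y * y) / y" "1 + y * y > 0"
      using that by (simp_all add: field_simps add_pos_pos)
    then show ?thesis using that by (simp add: divide_simps)
  qed
  have "tanh (a * t) - 1 = - 2 / (1 + exp (2 * a * t))"
    using *[of "exp (a * t)"] by (simp add: tanh_altdef exp_minus flip: exp_add)
  moreover have "rem a a t = (tanh (a * t) - 1) * t"
    using \<open>a > 0\<close> by (simp add: rem_def log_gini_def slope_def algebra_simps)
  ultimately show ?thesis by simp
qed

text \<open>Of the two \<open>ell\<close> terms the one with the smaller absolute parameter decays
  more slowly, and it enters with a minus sign. The sign of \<open>b\<close> only affects the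
  denominator, so the lemma serves inner slopes as well as slope 1.\<close>

lemma lead_rem:
  assumes "0 < \<bar>b\<bar>" "\<bar>b\<bar> < a"
  shows "lead (rem a b) \<bar>b\<bar> 0 (- (1 / (a - b)))"
proof -
  have "lead (\<lambda>t. (ell (a * t) - ell (\<bar>b\<bar> * t)) / (a - b)) \<bar>b\<bar> 0 ((0 - 1) / (a - b))"
    using assms by (intro lead_divide lead_diff lead_ell lead_faster[OF lead_ell]) auto
  moreover have "eventually (\<lambda>t. (ell (a * t) - ell (\<bar>b\<bar> * t)) / (a - b) = rem a b t) at_top"
    using eventually_ge_at_top[of 0]
  proof eventually_elim
    case (elim t) then show ?case using assms by (subst rem_eq_ell) auto
  qed
  ultimately show ?thesis using lead_cong by fastforce
qed

text \<open>On the diagonal the divided difference degenerates to a derivative in the parameter,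
  which brings down a factor \<open>t\<close>. This is why \<open>lead\<close> records a power of
  \<open>t\<close>.\<close>

lemma lead_rem_diag: "0 < a \<Longrightarrow> lead (rem a a) a 1 (- 2)"
proof -
  assume a: "0 < a"
  have "((\<lambda>t. - 2 / (1 + exp (- (2 * a * t)))) \<longlongrightarrow> - 2 / (1 + 0)) at_top"
    using lead_tendsto[OF lead_exp a] by (intro tendsto_intros) auto
  then have 1: "((\<lambda>t. - 2 / (1 + exp (- (2 * a * t)))) \<longlongrightarrow> - 2) at_top" by simp
  show ?thesis unfolding lead_def
  proof (rule Lim_transform_eventually[OF 1])
    show "eventually (\<lambda>t. - 2 / (1 + exp (- (2 * a * t))) = rem a a t * exp (2 * a * t) / t ^ 1) at_top"
      using eventually_gt_at_top[of 0]
    proof eventually_elim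
      case (elim t)
      have "1 + inverse y = (1 + y) / y" if "y > 0" for y :: real using that by (simp add: field_simps)
      from this[of "exp (2 * a * t)"] show ?case using elim a by (simp add: rem_diag exp_minus)
    qed
  qed
qed

text \<open>On the scale \<open>t * exp (- 2 * b * t)\<close> only diagonal pairs are visible.
  Comparing on it decides which pairs are diagonal before the finer scale without \<open>t\<close>
  is used.\<close>

lemma lead_rem_pos_1:
  assumes "0 < b" "b \<le> a"
  shows "lead (rem a b) b 1 (if a = b then - 2 else 0)"
  using assms lead_rem_diag[of a] lead_Suc[OF lead_rem[of b a]] by auto

lemma lead_rem_pos:
  assumes "0 < b" "b \<le> a"
  obtains j s where "s > 0" "lead (rem a b) b j (- s)"
proof (cases "a = b")
  case True then show ?thesis using that[of 2 1] lead_rem_diag[of b] assms by simp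
next
  case False then show ?thesis using that[of "1 / (a - b)" 0] lead_rem[of b a] assms by simp
qed

lemma lead_rem_faster: "0 < b \<Longrightarrow> b \<le> a \<Longrightarrow> n < b \<Longrightarrow> lead (rem a b) n i 0"
  using lead_faster[OF lead_rem_pos_1] by blast

lemma rem_0_eq: "a > 0 \<Longrightarrow> t \<ge> 0 \<Longrightarrow> rem a 0 t = ell (a * t) / a - ln 2 / a"
  by (subst rem_eq_ell) (auto simp: diff_divide_distrib)

lemma rem_tendsto:
  assumes "0 \<le> b" "b \<le> a" "0 < a"
  shows "(rem a b \<longlongrightarrow> (if b = 0 then - (ln 2 / a) else 0)) at_top"
proof (cases "b = 0")
  case True
  have "((\<lambda>t. ell (a * t) / a - ln 2 / a) \<longlongrightarrow> 0 / a - ln 2 / a) at_top"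
    using lead_tendsto[OF lead_ell] assms by (intro tendsto_intros) auto
  then have "(rem a 0 \<longlongrightarrow> 0 / a - ln 2 / a) at_top"
    by (rule Lim_transform_eventually)
      (use eventually_ge_at_top[of 0] in \<open>eventually_elim, use assms rem_0_eq in auto\<close>)
  with True show ?thesis by simp
next
  case False
  then show ?thesis using lead_tendsto[OF lead_rem_pos_1] assms by simp
qed

lemma rem_neg: "slope a b = 1 \<Longrightarrow> t > 0 \<Longrightarrow> rem a b t < 0"
  using abs_log_gini_less[of t a b] by (simp add: rem_def)

lemma log_gini_slope: "((\<lambda>t. log_gini a b t / t) \<longlongrightarrow> slope a b) at_top"
proof -
  have 1: "((\<lambda>t. log_gini a b t / t) \<longlongrightarrow> slope a b) at_top" if "(rem a b \<longlongrightarrow> L) at_top" for a b L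
  proof -
    have "((\<lambda>t. slope a b + rem a b t * inverse t) \<longlongrightarrow> slope a b + L * 0) at_top"
      by (intro tendsto_intros that tendsto_inverse_0_at_top filterlim_ident)
    then have "((\<lambda>t. slope a b + rem a b t * inverse t) \<longlongrightarrow> slope a b) at_top" by simp
    then show ?thesis
    proof (rule Lim_transform_eventually)
      show "eventually (\<lambda>t. slope a b + rem a b t * inverse t = log_gini a b t / t) at_top"
        using eventually_gt_at_top[of 0] by eventually_elim (simp add: log_gini_eq_rem field_simps)
    qed
  qed
  have *: "\<exists>L. (rem a b \<longlongrightarrow> L) at_top" if "b \<le> a" for a b
    using that
  proof (cases rule: slope_cases)
    case 1 then show ?thesis using rem_tendsto that by blast
  next
    case 2
    have "- rem (- b) (- a) t = rem a b t" for t by (simp add: rem_minus rem_commute[of b])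
    then show ?thesis using tendsto_minus[OF rem_tendsto[of "- a" "- b"]] that 2 by auto
  next
    case 3
    show ?thesis
    proof (cases "a + b = 0")
      case True
      then have "rem a b = (\<lambda>t. 0)" by (auto simp: rem_opposite)
      then show ?thesis using tendsto_const by metis
    next
      case False
      with 3 have ab: "b < 0" "0 < a" by auto
      have "((\<lambda>t. (ell (a * t) - ell (- b * t)) / (a - b)) \<longlongrightarrow> (0 - 0) / (a - b)) at_top"
        using ab lead_tendsto[OF lead_ell[of a]] lead_tendsto[OF lead_ell[of "- b"]]
        by (intro tendsto_intros) auto
      moreover have "eventually (\<lambda>t. (ell (a * t) - ell (- b * t)) / (a - b) = rem a b t) at_top"
        using eventually_ge_at_top[of 0] by eventually_elim (use ab in \<open>simp add: rem_eq_ell\<close>)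
      ultimately show ?thesis using Lim_transform_eventually by blast
    qed
  qed
  consider "b \<le> a" | "a \<le> b" by linarith
  then show ?thesis
  proof cases
    case 2
    from *[OF 2] 1 have "((\<lambda>t. log_gini b a t / t) \<longlongrightarrow> slope b a) at_top" by blast
    then show ?thesis by (simp add: log_gini_commute[of b] slope_commute[of b])
  qed (use 1 * in blast)
qed

lemma isCont_log_gini: "isCont (log_gini p q) x"
proof (cases "p = q")
  case True
  then have "log_gini p q = (\<lambda>t. t * tanh (p * t))" by (auto simp: log_gini_def)
  then show ?thesis by (auto intro!: continuous_intros)
next
  case False
  then have "log_gini p q = (\<lambda>t. (ln (cosh (p * t)) - ln (cosh (q * t))) / (p - q))"
    by (auto simp: log_gini_def)
  with False show ?thesis by (auto intro!: continuous_intros)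
qed

section \<open>Two necessary relations: quadratic terms at 0 and slopes at infinity\<close>

lemma log_invariant_sum:
  assumes "log_invariant a b c d p q"
  shows "a + b + c + d = 2 * (p + q)"
proof -
  let ?D = "\<lambda>t. (log_gini a b t - log_gini c d t) / 2"
  define \<rho> where "\<rho> x = (if x = 0 then (p + q) / 2 else log_gini p q x / x ^ 2)" for x
  have "(\<rho> \<longlongrightarrow> (p + q) / 2) (at 0)"
    by (rule Lim_transform_eventually[OF log_gini_quadratic]) (auto simp: eventually_at_filter \<rho>_def)
  then have \<rho>: "isCont \<rho> 0" by (simp add: isCont_def \<rho>_def)
  have \<rho>_mult: "\<rho> x * x ^ 2 = log_gini p q x" for x by (simp add: \<rho>_def)
  have "(?D \<longlongrightarrow> (log_gini a b 0 - log_gini c d 0) / 2) (at 0)"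
    by (intro tendsto_intros isCont_tendsto_compose[OF isCont_log_gini]) simp_all
  then have D: "(?D \<longlongrightarrow> 0) (at 0)" by simp
  \<comment> \<open>The inner argument \<open>?D t\<close> is itself of order \<open>t ^ 2\<close>,
    so the nested term is of order \<open>t ^ 4\<close> and disappears after division by
    \<open>t ^ 2\<close>. One factor \<open>?D t\<close> is kept apart to show this.\<close>
  have "((\<lambda>t. (log_gini a b t / t ^ 2 + log_gini c d t / t ^ 2) / 2 +
      \<rho> (?D t) * ((log_gini a b t / t ^ 2 - log_gini c d t / t ^ 2) / 2 * ?D t) - log_gini p q t / t ^ 2)
    \<longlongrightarrow> ((a + b) / 2 + (c + d) / 2) / 2 + \<rho> 0 * (((a + b) / 2 - (c + d) / 2) / 2 * 0) - (p + q) / 2) (at 0)"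
    by (intro tendsto_intros log_gini_quadratic isCont_tendsto_compose[OF \<rho>] D) simp_all
  note lim = this
  have gen: "(A / s + C / s) / 2 + r * ((A / s - C / s) / 2 * D) - G / s
      = ((A + C) / 2 + r * ((A - C) / 2 * D) - G) / s" for A C D s r G :: real
    unfolding divide_inverse by algebra
  have "(log_gini a b t / t ^ 2 + log_gini c d t / t ^ 2) / 2 +
      \<rho> (?D t) * ((log_gini a b t / t ^ 2 - log_gini c d t / t ^ 2) / 2 * ?D t) - log_gini p q t / t ^ 2 = 0" for t
  proof -
    have "(log_gini a b t / t ^ 2 + log_gini c d t / t ^ 2) / 2 +
      \<rho> (?D t) * ((log_gini a b t / t ^ 2 - log_gini c d t / t ^ 2) / 2 * ?D t) - log_gini p q t / t ^ 2
      = ((log_gini a b t + log_gini c d t) / 2 + \<rho> (?D t) * (?D t) ^ 2 - log_gini p q t) / t ^ 2"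
      unfolding gen by (simp only: power2_eq_square)
    also have "\<dots> = 0" using log_invariantD[OF assms, of t] by (simp only: \<rho>_mult) simp
    finally show ?thesis .
  qed
  with lim have "((\<lambda>t::real. 0) \<longlongrightarrow> ((a + b) / 2 + (c + d) / 2) / 2 + \<rho> 0 * (((a + b) / 2 - (c + d) / 2) / 2 * 0) - (p + q) / 2) (at 0)"
    by simp
  from tendsto_unique[OF _ this tendsto_const] show ?thesis by (simp add: field_simps)
qed

lemma log_invariant_slope:
  assumes "log_invariant a b c d p q" "slope c d \<le> slope a b"
  shows "(slope a b + slope c d) / 2 + slope p q * ((slope a b - slope c d) / 2) = slope p q"
proof -
  let ?D = "\<lambda>t. (log_gini a b t - log_gini c d t) / 2"
  define \<kappa> where "\<kappa> = (slope a b - slope c d) / 2"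
  have D: "((\<lambda>t. ?D t / t) \<longlongrightarrow> \<kappa>) at_top"
    using tendsto_divide[OF tendsto_diff[OF log_gini_slope[of a b] log_gini_slope[of c d]] tendsto_const[of 2]]
    by (simp add: \<kappa>_def diff_divide_distrib mult.commute)
  have R: "((\<lambda>t. log_gini p q (?D t) / t) \<longlongrightarrow> slope p q * \<kappa>) at_top"
  \<comment> \<open>For \<open>\<kappa> = 0\<close> the inner argument need not tend to infinity, so
    \<open>log_gini_slope\<close> cannot be composed with it; the bound
    \<open>abs_log_gini_le\<close> takes its place.\<close>
  proof (cases "\<kappa> = 0")
    case True
    have "((\<lambda>t. log_gini p q (?D t) / t) \<longlongrightarrow> 0) at_top"
    proof (rule tendsto_0_le)
      show "((\<lambda>t. ?D t / t) \<longlongrightarrow> 0) at_top" using D True by simp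
      show "eventually (\<lambda>t. norm (log_gini p q (?D t) / t) \<le> norm (?D t / t) * 1) at_top"
        by (intro always_eventually allI)
          (metis abs_divide divide_right_mono abs_ge_zero abs_log_gini_le mult.right_neutral real_norm_def)
    qed
    with True show ?thesis by simp
  next
    case False
    with assms(2) have \<kappa>: "\<kappa> > 0" by (simp add: \<kappa>_def)
    have "filterlim (\<lambda>t. ?D t / t * t) at_top at_top"
      by (rule filterlim_tendsto_pos_mult_at_top[OF D \<kappa> filterlim_ident])
    moreover have "eventually (\<lambda>t. ?D t / t * t = ?D t) at_top"
      using eventually_gt_at_top[of 0] by eventually_elim simp
    ultimately have lim: "filterlim ?D at_top at_top"
      using filterlim_cong[OF refl refl, of "\<lambda>t. ?D t / t * t" ?D] by blast
    have "((\<lambda>t. log_gini p q (?D t) / ?D t * (?D t / t)) \<longlongrightarrow> slope p q * \<kappa>) at_top"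
      by (intro tendsto_mult D filterlim_compose[OF log_gini_slope lim])
    then show ?thesis
    proof (rule Lim_transform_eventually)
      have "eventually (\<lambda>t. ?D t > 0) at_top" using lim unfolding filterlim_at_top_dense by blast
      then show "eventually (\<lambda>t. log_gini p q (?D t) / ?D t * (?D t / t) = log_gini p q (?D t) / t) at_top"
        by eventually_elim simp
    qed
  qed
  have "((\<lambda>t. (log_gini a b t / t + log_gini c d t / t) / 2 + log_gini p q (?D t) / t)
      \<longlongrightarrow> (slope a b + slope c d) / 2 + slope p q * \<kappa>) at_top"
    by (intro tendsto_intros log_gini_slope R) simp
  moreover have "(log_gini a b t / t + log_gini c d t / t) / 2 + log_gini p q (?D t) / t = log_gini p q t / t" for t
    using log_invariantD[OF assms(1), of t, symmetric] by (simp add: add_divide_distrib mult.commute)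
  ultimately have "((\<lambda>t. log_gini p q t / t) \<longlongrightarrow> (slope a b + slope c d) / 2 + slope p q * \<kappa>) at_top" by simp
  from tendsto_unique[OF _ this log_gini_slope] show ?thesis by (simp add: \<kappa>_def)
qed

subsection \<open>Equal slopes\<close>

lemma log_invariant_rem_equal_slopes:
  assumes "log_invariant a b c d p q" "slope a b = slope p q" "slope c d = slope p q"
  shows "(rem a b t + rem c d t) / 2 + log_gini p q ((rem a b t - rem c d t) / 2) = rem p q t"
proof -
  have "(rem a b t - rem c d t) / 2 = (log_gini a b t - log_gini c d t) / 2"
    by (simp add: rem_def assms)
  then show ?thesis using log_invariantD[OF assms(1), of t]
    by (simp only: rem_def assms(2,3)) argo
qed

text \<open>In the limit \<open>E\<close> reads \<open>exp (p * A) + exp (p * C) = 1\<close>. Both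
  summands are then below 1, which is only possible for \<open>b = d = 0\<close>. The sum relation
  makes \<open>p\<close> the average of \<open>a\<close> and \<open>c\<close>; if they differed, the
  exponential of the smaller one would have no partner.\<close>

lemma power_equal_slopes_aux:
  assumes inv: "log_invariant a b c d p 0"
    and ab: "0 \<le> b" "b \<le> a" "0 < a" and cd: "0 \<le> d" "d \<le> c" "0 < c" and p: "0 < p" and ca: "c \<le> a"
  shows "b = 0 \<and> d = 0 \<and> a = p \<and> c = p"
proof -
  define A C where "A = (if b = 0 then - (ln 2 / a) else 0)" and "C = (if d = 0 then - (ln 2 / c) else 0)"
  have sl: "slope a b = 1" "slope c d = 1" using ab cd by (simp_all add: slope_eq_1)
  have E: "exp (p * rem a b t) + exp (p * rem c d t) = 1 + exp (- (2 * p * t))" for t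
  proof -
    have "exp (p * log_gini a b t) + exp (p * log_gini c d t) = 2 * cosh (p * t)"
      using inv p by (simp add: log_invariant_power_iff)
    then have "exp (p * t) * (exp (p * rem a b t) + exp (p * rem c d t)) = exp (p * t) * (1 + exp (- (2 * p * t)))"
      by (simp add: log_gini_eq_rem sl cosh_def distrib_left exp_add[symmetric] add.commute)
    then show ?thesis by simp
  qed
  have "((\<lambda>t. exp (p * rem a b t) + exp (p * rem c d t)) \<longlongrightarrow> exp (p * A) + exp (p * C)) at_top"
    unfolding A_def C_def by (intro tendsto_intros rem_tendsto ab cd)
  then have "((\<lambda>t. 1 + exp (- (2 * p * t))) \<longlongrightarrow> exp (p * A) + exp (p * C)) at_top"
    by (simp add: E)
  moreover have "((\<lambda>t. 1 + exp (- (2 * p * t))) \<longlongrightarrow> 1 + 0) at_top"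
    by (intro tendsto_intros lead_tendsto[OF lead_exp] p)
  ultimately have AC: "exp (p * A) + exp (p * C) = 1"
    using tendsto_unique[OF trivial_limit_at_top_linorder] by fastforce
  have "exp (p * A) < 1" "exp (p * C) < 1" using AC exp_gt_zero[of "p * A"] exp_gt_zero[of "p * C"] by linarith+
  then have bd: "b = 0" "d = 0" by (auto simp: A_def C_def split: if_splits)
  have sum: "a + c = 2 * p" using log_invariant_sum[OF inv] bd by simp
  have "a = c"
  proof (rule ccontr)
    assume "a \<noteq> c"
    then have ca: "c < a" "c < p" using ca sum by auto
    define F where "F t = exp (p * A) * (exp (p / a * ell (a * t)) - 1) +
       exp (p * C) * (exp (p / c * ell (c * t)) - 1) - exp (- (2 * p * t))" for t
    have "lead F c 0 (exp (p * A) * 0 + exp (p * C) * (p / c * 1) - 0)"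
    proof -
      have "lead (\<lambda>t. exp (p / a * ell (a * t)) - 1) c 0 0"
        using lead_faster[OF lead_expm1[OF lead_cmult[OF lead_ell[of a], of "p / a"]]] ca ab by blast
      moreover have "lead (\<lambda>t. exp (p / c * ell (c * t)) - 1) c 0 (p / c * 1)"
        using lead_expm1[OF lead_cmult[OF lead_ell[of c], of "p / c"]] cd by blast
      moreover have "lead (\<lambda>t. exp (- (2 * p * t))) c 0 0" using lead_faster[OF lead_exp] ca by blast
      ultimately show ?thesis unfolding F_def by (intro lead_add lead_diff lead_cmult)
    qed
    moreover have "eventually (\<lambda>t. F t = 0) at_top"
      using eventually_ge_at_top[of 0]
    proof eventually_elim
      case (elim t)
      have "exp (p * rem a b t) = exp (p * A) * exp (p / a * ell (a * t))"
        "exp (p * rem c d t) = exp (p * C) * exp (p / c * ell (c * t))"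
        using elim ab cd bd by (simp_all add: rem_0_eq A_def C_def algebra_simps flip: exp_add)
      then show ?case using E[of t] AC by (simp add: F_def algebra_simps)
    qed
    ultimately have "exp (p * C) * (p / c) = 0" using lead_eq_0 by fastforce
    then show False using p cd by simp
  qed
  with bd sum show ?thesis by simp
qed

lemma power_equal_slopes:
  assumes "log_invariant a b c d p 0"
    and "0 \<le> b" "b \<le> a" "0 < a" "0 \<le> d" "d \<le> c" "0 < c" "0 < p"
  shows "b = 0 \<and> d = 0 \<and> a = p \<and> c = p"
proof (cases "c \<le> a")
  case True
  with power_equal_slopes_aux[OF assms] show ?thesis by blast
next
  case False
  with power_equal_slopes_aux[OF log_invariant_swap[OF assms(1)] assms(5-7,2-4,8)] show ?thesis by linarith
qed

text \<open>A vanishing parameter would show in the limits \<open>A\<close> and \<open>C\<close>.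
  The limit equation says that \<open>- (A + C) / 2\<close> is a \<open>log_gini\<close> value at
  \<open>(A - C) / 2\<close>, hence smaller in absolute value unless \<open>A = C\<close>; for
  numbers of equal sign this is impossible.\<close>

lemma equal_slopes_min_pos:
  assumes inv: "log_invariant a b c d p q"
    and ab: "0 \<le> b" "b \<le> a" "0 < a" and cd: "0 \<le> d" "d \<le> c" "0 < c" and pq: "0 < q" "q \<le> p"
  shows "0 < b \<and> 0 < d"
proof -
  define A C where "A = (if b = 0 then - (ln 2 / a) else 0)" and "C = (if d = 0 then - (ln 2 / c) else 0)"
  have sl: "slope a b = 1" "slope c d = 1" "slope p q = 1" using ab cd pq by (simp_all add: slope_eq_1)
  have "((\<lambda>t. (rem a b t + rem c d t) / 2 + log_gini p q ((rem a b t - rem c d t) / 2)) \<longlongrightarrow>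
      (A + C) / 2 + log_gini p q ((A - C) / 2)) at_top"
    unfolding A_def C_def
    by (intro tendsto_intros rem_tendsto ab cd isCont_tendsto_compose[OF isCont_log_gini]) simp_all
  then have "(rem p q \<longlongrightarrow> (A + C) / 2 + log_gini p q ((A - C) / 2)) at_top"
    using log_invariant_rem_equal_slopes[OF inv] sl by simp
  moreover have "(rem p q \<longlongrightarrow> 0) at_top" using rem_tendsto[of q p] pq by simp
  ultimately have *: "(A + C) / 2 + log_gini p q ((A - C) / 2) = 0" using tendsto_unique by force
  have AC: "A \<le> 0" "C \<le> 0" using ab cd by (auto simp: A_def C_def)
  have "A = C"
  proof (rule ccontr)
    assume "A \<noteq> C"
    then have "\<bar>log_gini p q ((A - C) / 2)\<bar> < \<bar>(A - C) / 2\<bar>" by (intro abs_log_gini_less) simp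
    moreover have "log_gini p q ((A - C) / 2) = - (A + C) / 2" using * by argo
    ultimately have "\<bar>- (A + C) / 2\<bar> < \<bar>(A - C) / 2\<bar>" by simp
    then show False using AC by (auto simp: abs_if field_simps split: if_splits)
  qed
  with * AC have "A = 0" "C = 0" by auto
  then show ?thesis using ab cd by (auto simp: A_def C_def split: if_splits)
qed

lemma lead_rem_pos_0: "0 < b \<Longrightarrow> b < a \<Longrightarrow> lead (rem a b) b 0 (- (1 / (a - b)))"
  using lead_rem[of b a] by simp

text \<open>The nested term is quadratic in the remainders, hence of exponent \<open>2 * m\<close>
  and invisible at first order.\<close>

lemma lead_rem_remainder:
  assumes "0 < b" "b \<le> a" "0 < d" "d \<le> c" "m \<le> b" "m \<le> d" "0 < m"
  shows "lead (\<lambda>t. log_gini p q ((rem a b t - rem c d t) / 2)) m i 0"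
proof -
  have "\<exists>x. lead (rem r s) m 1 x" if "0 < s" "s \<le> r" "m \<le> s" for r s
    using lead_rem_pos_1[OF that(1,2)] lead_rem_faster[OF that(1,2), of m 1] that(3) by (cases "m = s") auto
  then obtain x y where "lead (rem a b) m 1 x" "lead (rem c d) m 1 y" using assms by meson
  then have "lead (\<lambda>t. (rem a b t - rem c d t) / 2) m 1 ((x - y) / 2)"
    by (intro lead_divide lead_diff)
  from lead_log_gini[OF this \<open>0 < m\<close>] show ?thesis
    by (rule lead_faster) (use assms in simp)
qed

lemma equal_slopes_pos_ge:
  assumes inv: "log_invariant a b c d p q"
    and ab: "0 < b" "b \<le> a" and cd: "b \<le> d" "d \<le> c" and pq: "0 < q" "q \<le> p"
  shows "b \<le> q"
proof (rule ccontr)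
  assume q: "\<not> b \<le> q"
  obtain j s where s: "s > 0" "lead (rem p q) q j (- s)" using lead_rem_pos[OF pq] by blast
  have "lead (\<lambda>t. (rem a b t + rem c d t) / 2 + log_gini p q ((rem a b t - rem c d t) / 2)) q j ((0 + 0) / 2 + 0)"
    using q assms by (intro lead_add lead_divide lead_rem_remainder lead_rem_faster) auto
  then have "lead (rem p q) q j 0"
    using assms by (subst (asm) log_invariant_rem_equal_slopes[OF inv]) (simp_all add: slope_eq_1)
  with s lead_unique show False by fastforce
qed

text \<open>Both sides have slowest exponent \<open>b\<close>. The coefficients with a factor
  \<open>t\<close> are 0 or \<open>- 2\<close> and have to average, so either all pairs are diagonal
  or none is; in the latter case the coefficients without \<open>t\<close> decide.\<close>

lemma equal_slopes_pos_eq: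
  assumes inv: "log_invariant a b c b p q"
    and ab: "0 < b" "b \<le> a" "b \<le> c" and pq: "0 < q" "q \<le> p"
  shows "q = b \<and> a = p \<and> c = p"
proof -
  have bq: "b \<le> q" using equal_slopes_pos_ge[OF inv] assms by simp
  have sum: "a + c + 2 * b = 2 * (p + q)" using log_invariant_sum[OF inv] by simp
  have E: "(rem a b t + rem c b t) / 2 + log_gini p q ((rem a b t - rem c b t) / 2) = rem p q t" for t
    using log_invariant_rem_equal_slopes[OF inv] assms by (simp add: slope_eq_1)
  have R: "lead (\<lambda>t. log_gini p q ((rem a b t - rem c b t) / 2)) b i 0" for i
    using lead_rem_remainder assms by simp
  have 1: "lead (rem p q) b 1 (((if a = b then - 2 else 0) + (if c = b then - 2 else 0)) / 2 + 0)"
    using lead_add[OF lead_divide[OF lead_add[OF lead_rem_pos_1[OF ab(1,2)] lead_rem_pos_1[OF ab(1,3)]], of 2] R]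
    by (simp add: E)
  have 2: "lead (rem p q) b 1 (if q = b \<and> p = b then - 2 else 0)"
    using lead_rem_pos_1[OF pq] lead_rem_faster[OF pq, of b] bq by (cases "q = b") auto
  have 3: "((if a = b then - 2 else 0) + (if c = b then - 2 else 0)) / 2 + 0 = (if q = b \<and> p = b then - 2 else (0::real))"
    by (rule lead_unique[OF 1 2])
  show ?thesis
  proof (cases "a = b")
    case True with 3 sum show ?thesis by (auto split: if_splits)
  next
    case False
    with 3 have ac: "b < a" "b < c" "\<not> (q = b \<and> p = b)" using ab by (auto split: if_splits)
    have 4: "lead (rem p q) b 0 ((- (1 / (a - b)) + - (1 / (c - b))) / 2 + 0)"
      using lead_add[OF lead_divide[OF lead_add[OF lead_rem_pos_0[of b a] lead_rem_pos_0[of b c]], of 2] R] ac ab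
      by (simp add: E)
    have pos: "1 / (a - b) > 0" "1 / (c - b) > 0" using ac by simp_all
    have "q = b"
    proof (rule ccontr)
      assume "q \<noteq> b"
      then have "lead (rem p q) b 0 0" using lead_rem_faster[OF pq, of b] bq by auto
      from lead_unique[OF 4 this] pos show False by simp
    qed
    with ac pq have "b < p" by auto
    with lead_unique[OF 4] lead_rem_pos_0[of b p] ab \<open>q = b\<close>
    have "(- (1 / (a - b)) + - (1 / (c - b))) / 2 + 0 = - (1 / (p - b))" by blast
    then have eq: "(1 / (a - b) + 1 / (c - b)) / 2 = 1 / (p - b)" by argo
    \<comment> \<open>By \<open>eq\<close>, \<open>p - b\<close> is the harmonic mean of
      \<open>x\<close> and \<open>y\<close>; by the sum relation it is their arithmetic mean. The
      two agree only for \<open>x = y\<close>.\<close>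
    define x y where "x = a - b" and "y = c - b"
    have "p - b = (x + y) / 2" "x > 0" "y > 0" using sum \<open>q = b\<close> ac by (simp_all add: x_def y_def field_simps)
    with eq have "(1 / x + 1 / y) / 2 = 1 / ((x + y) / 2)" unfolding x_def[symmetric] y_def[symmetric]
      by metis
    then have "(x + y) * (x + y) = 4 * (x * y)" using \<open>x > 0\<close> \<open>y > 0\<close> by (simp add: field_simps)
    then have "(x - y)^2 = 0" by (simp add: power2_eq_square algebra_simps)
    then have "a = c" by (simp add: x_def y_def)
    with sum \<open>q = b\<close> show ?thesis by simp
  qed
qed

text \<open>At first order only the first pair contributes at exponent \<open>b\<close>. This is
  consistent: it gives \<open>q = b\<close> and \<open>p - b = 2 * (a - b)\<close>. The
  contradiction has to come from the terms behind it.\<close>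

lemma equal_slopes_pos_less:
  assumes inv: "log_invariant a b c d p q"
    and ab: "0 < b" "b \<le> a" and cd: "b < d" "d \<le> c" and pq: "0 < q" "q \<le> p"
  shows False
proof -
  have bq: "b \<le> q" using equal_slopes_pos_ge[OF inv] assms by simp
  have sum: "a + b + c + d = 2 * (p + q)" by (rule log_invariant_sum[OF inv])
  have E: "(rem a b t + rem c d t) / 2 + log_gini p q ((rem a b t - rem c d t) / 2) = rem p q t" for t
    using log_invariant_rem_equal_slopes[OF inv] assms by (simp add: slope_eq_1)
  have R: "lead (\<lambda>t. log_gini p q ((rem a b t - rem c d t) / 2)) b i 0" for i
    using lead_rem_remainder assms by simp
  have C: "lead (rem c d) b i 0" for i using lead_rem_faster assms by simp
  have 1: "lead (rem p q) b 1 (((if a = b then - 2 else 0) + 0) / 2 + 0)"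
    using lead_add[OF lead_divide[OF lead_add[OF lead_rem_pos_1[OF ab(1,2)] C], of 2] R]
    by (simp add: E)
  have 2: "lead (rem p q) b 1 (if q = b \<and> p = b then - 2 else 0)"
    using lead_rem_pos_1[OF pq] lead_rem_faster[OF pq, of b] bq by (cases "q = b") auto
  have "((if a = b then - 2 else 0) + 0) / 2 + 0 = (if q = b \<and> p = b then - 2 else (0::real))"
    by (rule lead_unique[OF 1 2])
  then have ac: "b < a" "\<not> (q = b \<and> p = b)" using ab by (auto split: if_splits)
  have 4: "lead (rem p q) b 0 ((- (1 / (a - b)) + 0) / 2 + 0)"
    using lead_add[OF lead_divide[OF lead_add[OF lead_rem_pos_0[of b a] C], of 2] R] ac ab
    by (simp add: E)
  have pos: "1 / (a - b) > 0" using ac by simp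
  have q: "q = b"
  proof (rule ccontr)
    assume "q \<noteq> b"
    then have "lead (rem p q) b 0 0" using lead_rem_faster[OF pq, of b] bq by auto
    from lead_unique[OF 4 this] pos show False by simp
  qed
  with ac pq have "b < p" by auto
  with lead_unique[OF 4] lead_rem_pos_0[of b p] ab q
  have "(- (1 / (a - b)) + 0) / 2 + 0 = - (1 / (p - b))" by blast
  then have "p - b = 2 * (a - b)" using ac \<open>b < p\<close> by (simp add: field_simps)
  then have p: "p = 2 * a - b" and pq': "p - q = 2 * (a - b)" using q by simp_all
  have c: "c + d = 3 * a - b" using sum p q by simp
  \<comment> \<open>The leading terms are exhausted; the second order compares \<open>d\<close> with \<open>a\<close> (from the first mean)
    and with \<open>2 * b\<close> (from the quadratic remainder \<open>R\<close>).\<close>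
  define R where "R t = log_gini p q ((rem a b t - rem c d t) / 2)" for t
  have R0: "R t \<ge> 0" for t unfolding R_def using pq by (intro log_gini_nonneg) auto
  have F: "ell (a * t) / (2 * (a - b)) + rem c d t / 2 + R t = ell (p * t) / (2 * (a - b))" if "t \<ge> 0" for t
  proof -
    have "rem a b t / 2 = ell (a * t) / (2 * (a - b)) - ell (b * t) / (2 * (a - b))"
      using that ac ab rem_eq_ell[of a b t] by (simp add: diff_divide_distrib mult.commute[of _ 2])
    moreover have "rem p q t = (ell (p * t) - ell (b * t)) / (2 * (a - b))"
      using that ab \<open>b < p\<close> q rem_eq_ell[of p q t] unfolding pq'[symmetric] by simp
    then have "rem p q t = ell (p * t) / (2 * (a - b)) - ell (b * t) / (2 * (a - b))"
      unfolding diff_divide_distrib .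
    ultimately
    show ?thesis using E[of t] unfolding R_def[symmetric] by argo
  qed
  have D: "lead (\<lambda>t. (rem a b t - rem c d t) / 2) b 0 ((- (1 / (a - b)) - 0) / 2)"
    using lead_rem[of b a] ac ab C by (intro lead_divide lead_diff) auto
  have R: "lead R (2 * b) 0 (a * (1 / (2 * (a - b))) ^ 2)"
  proof -
    have "((- (1 / z) - 0) / 2) ^ 2 = (1 / (2 * z)) ^ 2" for z :: real by (simp add: power2_eq_square)
    moreover have "(p + q) / 2 = a" using p q by simp
    ultimately show ?thesis using lead_log_gini[OF D ab(1), of p q] unfolding R_def mult_0_right by metis
  qed
  have Rpos: "a * (1 / (2 * (a - b))) ^ 2 > 0" using ac ab by simp
  have F': "eventually (\<lambda>t. ell (a * t) / (2 * (a - b)) + rem c d t / 2 + R t - ell (p * t) / (2 * (a - b)) = 0) at_top"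
    using eventually_ge_at_top[of 0]
  proof eventually_elim
    case (elim t) show ?case using F[OF elim] by linarith
  qed
  have pa: "a < p" using p ac by simp
  \<comment> \<open>In \<open>F'\<close> the terms \<open>ell (a * t)\<close> and \<open>R\<close>
    are positive and \<open>rem c d\<close> is negative, while \<open>ell (p * t)\<close> decays
    faster than \<open>ell (a * t)\<close>. For \<open>d = a\<close> everything but \<open>R\<close>
    cancels. The only other balance is \<open>d = 2 * b < a\<close>, where equal coefficients would
    force \<open>a = 2 * b\<close> or \<open>a = - b\<close>.\<close>
  consider "a < d" | "d = a" | "d < a" "d < 2 * b" | "2 * b < d" "d < a" | "d < a" "d = 2 * b" by linarith
  then show False
  proof cases
    case 1
    have "lead (\<lambda>t. ell (a * t) / (2 * (a - b)) + rem c d t / 2 - ell (p * t) / (2 * (a - b))) a 0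
       (1 / (2 * (a - b)) + 0 / 2 - 0 / (2 * (a - b)))"
      using 1 assms pa by (intro lead_add lead_diff lead_divide lead_ell lead_rem_faster lead_faster[OF lead_ell]) auto
    moreover have "eventually (\<lambda>t. ell (a * t) / (2 * (a - b)) + rem c d t / 2 - ell (p * t) / (2 * (a - b)) \<le> 0) at_top"
      using F' by eventually_elim (use R0 in \<open>smt (verit)\<close>)
    ultimately have "1 / (2 * (a - b)) + 0 / 2 - 0 / (2 * (a - b)) \<le> 0" by (rule lead_nonpos)
    with ac show False by simp
  next
    case 2
    with c p have "c = p" by simp
    have "eventually (\<lambda>t. R t = 0) at_top"
      using eventually_ge_at_top[of 0]
    proof eventually_elim
      case (elim t)
      have "rem c d t / 2 = ell (p * t) / (2 * (a - b)) - ell (a * t) / (2 * (a - b))"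
      proof -
        have "c - d = a - b" using 2 \<open>c = p\<close> p by simp
        then show ?thesis using elim 2 \<open>c = p\<close> pa ab rem_eq_ell[of c d t]
          by (simp add: diff_divide_distrib mult.commute[of _ 2])
      qed
      with F[OF elim] show ?case by simp
    qed
    from lead_eq_0[OF R this] Rpos show False by linarith
  next
    case 3
    have d: "0 < d" using ab cd by simp
    obtain j s where s: "s > 0" "lead (rem c d) d j (- s)" using lead_rem_pos[OF d cd(2)] by blast
    have "lead (\<lambda>t. ell (a * t) / (2 * (a - b)) + rem c d t / 2 + R t - ell (p * t) / (2 * (a - b))) d j
       (0 / (2 * (a - b)) + (- s) / 2 + 0 - 0 / (2 * (a - b)))"
      using 3 assms pa by (intro lead_add lead_diff lead_divide s lead_faster[OF lead_ell] lead_faster[OF R]) auto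
    from lead_eq_0[OF this F'] s show False by simp
  next
    case 4
    have "lead (\<lambda>t. ell (a * t) / (2 * (a - b)) + rem c d t / 2 + R t - ell (p * t) / (2 * (a - b))) (2 * b) 0
       (0 / (2 * (a - b)) + 0 / 2 + a * (1 / (2 * (a - b))) ^ 2 - 0 / (2 * (a - b)))"
      using 4 assms pa by (intro lead_add lead_diff lead_divide R lead_rem_faster lead_faster[OF lead_ell]) auto
    from lead_eq_0[OF this F'] Rpos show False by argo
  next
    case 5
    with c have c': "c = 3 * a - 3 * b" by simp
    then have cd': "d < c" using 5 ab by simp
    have "lead (rem c d) (2 * b) 0 (- (1 / (c - d)))" using lead_rem[of d c] 5 cd' ab by simp
    then have "lead (\<lambda>t. ell (a * t) / (2 * (a - b)) + rem c d t / 2 + R t - ell (p * t) / (2 * (a - b))) (2 * b) 0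
       (0 / (2 * (a - b)) + - (1 / (c - d)) / 2 + a * (1 / (2 * (a - b))) ^ 2 - 0 / (2 * (a - b)))"
      using 5 assms pa by (intro lead_add lead_diff lead_divide R lead_faster[OF lead_ell]) auto
    from lead_eq_0[OF this F'] have "a / (2 * (a - b)) ^ 2 = 1 / (2 * (c - d))"
      by (simp add: power_divide)
    then have "a * (2 * (c - d)) = (2 * (a - b)) ^ 2" using ac cd' by (simp add: divide_simps)
    then have "(a - 2 * b) * (a + b) = 0" using c' 5 by (simp add: power2_eq_square algebra_simps)
    with 5 ab show False by auto
  qed
qed

lemma equal_slopes_one:
  assumes inv: "log_invariant a b c d p q"
    and ab: "0 \<le> b" "b \<le> a" "0 < a" and cd: "0 \<le> d" "d \<le> c" "0 < c" and pq: "0 \<le> q" "q \<le> p" "0 < p"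
  shows "a = p \<and> b = q \<and> c = p \<and> d = q"
proof (cases "q = 0")
  case True
  then show ?thesis using power_equal_slopes assms by blast
next
  case False
  with pq have q: "0 < q" by simp
  have pos: "0 < b" "0 < d" using equal_slopes_min_pos[OF inv ab cd q pq(2)] by simp_all
  consider "b < d" | "d < b" | "b = d" by linarith
  then show ?thesis
  proof cases
    case 1 then show ?thesis using equal_slopes_pos_less[OF inv pos(1) ab(2) _ cd(2) q pq(2)] by simp
  next
    case 2 then show ?thesis
      using equal_slopes_pos_less[OF log_invariant_swap[OF inv] pos(2) cd(2) _ ab(2) q pq(2)] by simp
  next
    case 3 then show ?thesis
      using equal_slopes_pos_eq[of a b c p q] inv pos ab cd q pq by simp
  qed
qed

text \<open>An inner slope \<open>k\<close> fixes the ratio \<open>- b / a\<close> to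
  \<open>(1 - k) / (1 + k)\<close>, so all three pairs are multiples of \<open>(1, - l)\<close>. The
  sum relation makes \<open>p\<close> the average of \<open>a\<close> and \<open>c\<close>, and the
  smaller of these would leave an exponential without a partner.\<close>

lemma equal_slopes_mixed_aux:
  assumes inv: "log_invariant a b c d p q"
    and ab: "b < 0" "0 < a" and cd: "d < 0" "0 < c" and pq: "q < 0" "0 < p"
    and sl: "slope a b = k" "slope c d = k" "slope p q = k" and k: "0 < k" and "c \<le> a"
  shows "a = p \<and> b = q \<and> c = p \<and> d = q"
proof -
  define l where "l = (1 - k) / (1 + k)"
  have *: "y = - (l * x) \<and> - y < x" if "y < 0" "0 < x" "slope x y = k" for x y
  proof
    have eq: "x + y = k * (x - y)" using that slope_mixed[OF that(1,2)] by (simp add: field_simps)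
    then show "y = - (l * x)" using k by (simp add: l_def field_simps)
    have "0 < k * (x - y)" using that k by simp
    with eq show "- y < x" by simp
  qed
  have l: "b = - (l * a)" "d = - (l * c)" "q = - (l * p)"
    and lt: "- b < a" "- d < c" "- q < p" using * ab cd pq sl by blast+
  have lpos: "0 < l" "l < 1" using l(1) ab lt(1) by (simp_all add: zero_less_mult_iff)
  have "(1 - l) * (a + c) = (1 - l) * (2 * p)"
    using log_invariant_sum[OF inv] l by (simp add: algebra_simps)
  then have sum: "a + c = 2 * p" using lpos by simp
  have "a = c"
  proof (rule ccontr)
    assume "a \<noteq> c"
    with \<open>c \<le> a\<close> sum have ca: "c < a" "c < p" by auto
    have m: "l * c < l * a" "l * c < l * p" "0 < l * c" using ca lpos cd by simp_all
    have C: "lead (rem c d) (l * c) 0 (- (1 / (c - d)))"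
      using lead_rem[of d c] l lt cd by simp
    have A: "lead (rem a b) (l * c) 0 0" using lead_faster[OF lead_rem[of b a], of "l * c"] m l lt ab by simp
    have P: "lead (rem p q) (l * c) 0 0" using lead_faster[OF lead_rem[of q p], of "l * c"] m l lt pq by simp
    have "lead (\<lambda>t. log_gini p q ((rem a b t - rem c d t) / 2)) (l * c) 0 0"
      using lead_log_gini[OF lead_divide[OF lead_diff[OF A C], of 2] m(3), of p q]
      by (rule lead_faster) (use m in linarith)
    then have "lead (\<lambda>t. (rem a b t + rem c d t) / 2 + log_gini p q ((rem a b t - rem c d t) / 2)) (l * c) 0
      ((0 + - (1 / (c - d))) / 2 + 0)" by (intro lead_add lead_divide A C)
    then have "lead (rem p q) (l * c) 0 ((0 + - (1 / (c - d))) / 2 + 0)"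
      using sl by (subst (asm) log_invariant_rem_equal_slopes[OF inv]) simp_all
    from lead_unique[OF this P] cd show False by simp
  qed
  with sum l show ?thesis by simp
qed

lemma equal_slopes_mixed:
  assumes inv: "log_invariant a b c d p q"
    and "b < 0" "0 < a" "d < 0" "0 < c" "q < 0" "0 < p"
    and sl: "slope a b = k" "slope c d = k" "slope p q = k" and k: "0 < k"
  shows "a = p \<and> b = q \<and> c = p \<and> d = q"
proof (cases "c \<le> a")
  case True
  with equal_slopes_mixed_aux[OF assms] show ?thesis by blast
next
  case False
  with equal_slopes_mixed_aux[OF log_invariant_swap[OF inv] assms(4,5,2,3,6,7,9,8,10,11)] show ?thesis by linarith
qed

subsection \<open>Opposite extremal slopes\<close>

lemma lead_rem_diag_2:
  assumes "0 < a"
  shows "lead (\<lambda>t. rem a a t + 2 * t * exp (- (2 * a * t))) (2 * a) 1 2"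
proof -
  have "((\<lambda>t. 2 / (1 + exp (- (2 * a * t)))) \<longlongrightarrow> 2 / (1 + 0)) at_top"
    using lead_tendsto[OF lead_exp assms] by (intro tendsto_intros) auto
  then have 1: "((\<lambda>t. 2 / (1 + exp (- (2 * a * t)))) \<longlongrightarrow> 2) at_top" by simp
  show ?thesis unfolding lead_def
  proof (rule Lim_transform_eventually[OF 1])
    show "eventually (\<lambda>t. 2 / (1 + exp (- (2 * a * t))) =
        (rem a a t + 2 * t * exp (- (2 * a * t))) * exp (2 * (2 * a) * t) / t ^ 1) at_top"
      using eventually_gt_at_top[of 0]
    proof eventually_elim
      case (elim t)
      have gen: "2 / (1 + inverse y) = (- (2 * t) / (1 + y) + 2 * t * inverse y) * (y * y) / t" if "y > 0" for y :: real
      proof -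
        have "- (2 * t) / (1 + y) + 2 * t * inverse y = 2 * t / (y * (1 + y))"
          using that by (simp add: divide_simps add_pos_pos) (simp add: algebra_simps)
        moreover have "1 + inverse y = (1 + y) / y" using that by (simp add: field_simps)
        ultimately show ?thesis using that elim by simp
      qed
      have "exp (2 * (2 * a) * t) = exp (2 * a * t) * exp (2 * a * t)" by (simp flip: exp_add)
      with gen[of "exp (2 * a * t)"] show ?case using assms by (simp add: rem_diag exp_minus)
    qed
  qed
qed

text \<open>The second mean is written with negated parameters so that its logarithm is
  \<open>- (t + rem e f t)\<close>. The inner argument is then \<open>t\<close> itself up to a
  convergent shift.\<close>

lemma log_invariant_rem_opposite_slopes:
  assumes inv: "log_invariant a b (- f) (- e) p q" and sl: "slope a b = 1" "slope e f = 1"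
  shows "(rem a b t - rem e f t) / 2 + log_gini p q (t + (rem a b t + rem e f t) / 2) = log_gini p q t"
proof -
  have "log_gini (- f) (- e) t = - (t + rem e f t)"
    unfolding log_gini_minus log_gini_commute[of f e] by (simp add: log_gini_eq_rem sl)
  moreover have "log_gini a b t = t + rem a b t" by (simp add: log_gini_eq_rem sl)
  moreover have "(t + x - - (t + y)) / 2 = t + (x + y) / 2" "(t + x + - (t + y)) / 2 = (x - y) / 2" for x y :: real
    by (simp_all add: field_simps)
  ultimately show ?thesis using log_invariantD[OF inv, of t] by metis
qed

text \<open>The limit shows whether the smaller parameter is 0; otherwise the slowest exponent is
  the smaller parameter. The sum then gives the other one.\<close>

lemma rem_inj:
  assumes eq: "\<And>t. rem a b t = rem e f t" and sum: "a + b = e + f"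
    and ab: "0 \<le> b" "b \<le> a" "0 < a" and ef: "0 \<le> f" "f \<le> e" "0 < e"
  shows "a = e \<and> b = f"
proof -
  have *: "rem a b = rem e f" using eq by auto
  have "(if b = 0 then - (ln 2 / a) else 0) = (if f = 0 then - (ln 2 / e) else 0)"
    using rem_tendsto[OF ab] rem_tendsto[OF ef] unfolding * by (rule tendsto_unique[OF trivial_limit_at_top_linorder])
  then have z: "b = 0 \<longleftrightarrow> f = 0" using ab ef by (auto split: if_splits)
  show ?thesis
  proof (cases "b = 0")
    case True with z sum show ?thesis by simp
  next
    case False
    with z ab ef have pos: "0 < b" "0 < f" by auto
    obtain j s where s: "s > 0" "lead (rem a b) b j (- s)" using lead_rem_pos[OF pos(1) ab(2)] by blast
    obtain j' s' where s': "s' > 0" "lead (rem e f) f j' (- s')" using lead_rem_pos[OF pos(2) ef(2)] by blast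
    have "\<not> b < f" using lead_unique[OF s(2)] lead_rem_faster[OF pos(2) ef(2)] s(1) unfolding * by fastforce
    moreover have "\<not> f < b"
      using lead_unique[OF s'(2)] lead_rem_faster[OF pos(1) ab(2)] s'(1) unfolding * by fastforce
    ultimately show ?thesis using sum by simp
  qed
qed

lemma opposite_slopes_geometric:
  assumes inv: "log_invariant a b (- f) (- e) p q" and "p + q = 0"
    and ab: "0 \<le> b" "b \<le> a" "0 < a" and ef: "0 \<le> f" "f \<le> e" "0 < e"
  shows "a = e \<and> b = f"
proof (rule rem_inj[OF _ _ ab ef])
  have sl: "slope a b = 1" "slope e f = 1" using ab ef by (simp_all add: slope_eq_1)
  show "rem a b t = rem e f t" for t
    using log_invariant_rem_opposite_slopes[OF inv sl, of t] assms(2) by (simp add: log_gini_opposite)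
  show "a + b = e + f" using log_invariant_sum[OF inv] assms(2) by simp
qed

lemma log_gini_mixed_eq:
  assumes "0 < r" "0 < p" "0 \<le> x"
  shows "(p + r) * log_gini p (- r) x = (p - r) * x + ell (p * x) - ell (r * x)"
proof -
  have "log_gini p (- r) x = ((p - r) * x + (ell (p * x) - ell (r * x))) / (p + r)"
    using assms rem_eq_ell[of p "- r" x] slope_mixed[of "- r" p]
    by (simp add: log_gini_eq_rem add_divide_distrib)
  then show ?thesis using assms by simp
qed

lemma filterlim_mult_add_at_top:
  assumes "(e \<longlongrightarrow> \<delta>) at_top" "0 < k"
  shows "filterlim (\<lambda>t::real. k * t + e t) at_top at_top"
proof -
  have "filterlim (\<lambda>t. e t + k * t) at_top at_top"
    by (intro filterlim_tendsto_add_at_top[OF assms(1)] filterlim_tendsto_pos_mult_at_top[OF tendsto_const assms(2)] filterlim_ident)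
  then show ?thesis by (simp add: add.commute)
qed

lemma double_of_proportional:
  fixes x y p r :: real
  assumes "p * y = r * x" "x - y = 2 * (p - r)" "p \<noteq> r"
  shows "x = 2 * p \<and> y = 2 * r"
proof -
  have "x = y + 2 * (p - r)" using assms(2) by simp
  with assms(1) have "(p - r) * (y - 2 * r) = 0" by (simp add: algebra_simps)
  with assms(2,3) show ?thesis by auto
qed

text \<open>After multiplication by \<open>p + r\<close> the remainders carry the weights
  \<open>p\<close> and \<open>r\<close>. Limits and leading terms give \<open>b = f\<close>, a
  proportion with ratio \<open>p : r\<close> and, with the sum relation,
  \<open>a - b = 2 * p\<close> and \<open>e - b = 2 * r\<close>. Up to there nothing contradicts;
  what fails is \<open>dp r\<close>, the effect of the shift on \<open>ell (r * t)\<close>.\<close>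

lemma opposite_slopes_mixed:
  assumes inv: "log_invariant a b (- f) (- e) p (- r)"
    and ab: "0 \<le> b" "b \<le> a" "0 < a" and ef: "0 \<le> f" "f \<le> e" "0 < e" and pr: "0 < r" "r < p"
  shows False
proof -
  have sl: "slope a b = 1" "slope e f = 1" using ab ef by (simp_all add: slope_eq_1)
  have sum: "a + b - e - f = 2 * (p - r)" using log_invariant_sum[OF inv] by simp
  define A C where "A = (if b = 0 then - (ln 2 / a) else 0)" and "C = (if f = 0 then - (ln 2 / e) else 0)"
  define \<epsilon> where "\<epsilon> t = (rem a b t + rem e f t) / 2" for t
  have A: "(rem a b \<longlongrightarrow> A) at_top" and C: "(rem e f \<longlongrightarrow> C) at_top"
    unfolding A_def C_def using rem_tendsto[OF ab] rem_tendsto[OF ef] by simp_all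
  have \<epsilon>: "(\<epsilon> \<longlongrightarrow> (A + C) / 2) at_top" unfolding \<epsilon>_def by (intro tendsto_intros A C) simp
  define dp where "dp s t = ell (s * (t + \<epsilon> t)) - ell (s * t)" for s t
  have F: "eventually (\<lambda>t. p * rem a b t - r * rem e f t + dp p t - dp r t = 0) at_top"
  proof -
    have "filterlim (\<lambda>t. 1 * t + \<epsilon> t) at_top at_top" by (intro filterlim_mult_add_at_top[OF \<epsilon>]) simp
    then have "eventually (\<lambda>t. 0 \<le> 1 * t + \<epsilon> t) at_top" unfolding filterlim_at_top by blast
    with eventually_ge_at_top[of 0] show ?thesis
    proof eventually_elim
      case (elim t)
      have "(p + r) * ((rem a b t - rem e f t) / 2) + (p + r) * log_gini p (- r) (t + \<epsilon> t) = (p + r) * log_gini p (- r) t"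
        using log_invariant_rem_opposite_slopes[OF inv sl, of t]
        unfolding \<epsilon>_def distrib_left[symmetric] by simp
      moreover have "(p + r) * log_gini p (- r) (t + \<epsilon> t) = (p - r) * (t + \<epsilon> t) + ell (p * (t + \<epsilon> t)) - ell (r * (t + \<epsilon> t))"
        using elim pr by (intro log_gini_mixed_eq) auto
      moreover have "(p + r) * log_gini p (- r) t = (p - r) * t + ell (p * t) - ell (r * t)"
        using elim pr by (intro log_gini_mixed_eq) auto
      moreover have "(p + r) * ((x - y) / 2) + (p - r) * (t + (x + y) / 2) = (p - r) * t + p * x - r * y" for x y
        by (simp add: field_simps)
      from this[of "rem a b t" "rem e f t"]
      have "(p + r) * ((rem a b t - rem e f t) / 2) + (p - r) * (t + \<epsilon> t) = (p - r) * t + p * rem a b t - r * rem e f t"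
        by (simp only: \<epsilon>_def)
      ultimately show ?case by (simp add: dp_def)
    qed
  qed
  have dp_lim: "(dp s \<longlongrightarrow> 0) at_top" if "0 < s" for s
  proof -
    have "((\<lambda>t. ell (s * (1 * t + \<epsilon> t)) - ell (s * t)) \<longlongrightarrow> 0 - 0) at_top"
      using that by (intro tendsto_diff lead_tendsto[OF lead_ell_shift[OF \<epsilon>]] lead_tendsto[OF lead_ell]) auto
    then show ?thesis by (simp add: dp_def[abs_def])
  qed
  have "((\<lambda>t. p * rem a b t - r * rem e f t + dp p t - dp r t) \<longlongrightarrow> p * A - r * C + 0 - 0) at_top"
    using pr by (intro tendsto_intros A C dp_lim) auto
  then have "lead (\<lambda>t. p * rem a b t - r * rem e f t + dp p t - dp r t) 0 0 (p * A - r * C + 0 - 0)"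
    by (rule tendsto_leadD)
  from lead_eq_0[OF this F] have AC: "p * A = r * C" by simp
  then have z: "b = 0 \<longleftrightarrow> f = 0" using pr ab ef by (auto simp: A_def C_def split: if_splits)
  show False
  proof (cases "b = 0")
    case True
    with z AC pr ab ef have "p * e = r * a" by (simp add: A_def C_def field_simps)
    moreover have "a - e = 2 * (p - r)" using sum True z by simp
    ultimately have "a = 2 * p \<and> e = 2 * r" using pr(2) by (intro double_of_proportional) simp_all
    then have ae: "a = 2 * p" "e = 2 * r" by blast+
    \<comment> \<open>The exponents of the other terms are at least \<open>r\<close>, and at
      \<open>r\<close> only the shifted and the unshifted \<open>ell\<close> with factor
      \<open>r\<close> meet. As the shift has a negative limit, their coefficients differ.\<close>
    define G where "G t = 1 / 2 * ell (a * t) - 1 / 2 * ell (e * t) + ell (p * (1 * t + \<epsilon> t)) - ell (p * t)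
      - ell (r * (1 * t + \<epsilon> t)) + ell (r * t)" for t
    have 1: "lead (\<lambda>t. ell (r * (1 * t + \<epsilon> t))) r 0 (exp (- (2 * r * ((A + C) / 2))))"
      using lead_ell_shift[OF \<epsilon>, of r 1] pr by simp
    have 2: "lead (\<lambda>t. ell (p * (1 * t + \<epsilon> t))) r 0 0"
      using lead_faster[OF lead_ell_shift[OF \<epsilon>, of p 1]] pr by simp
    have "lead G r 0 (1 / 2 * 0 - 1 / 2 * 0 + 0 - 0 - exp (- (2 * r * ((A + C) / 2))) + 1)"
      unfolding G_def using ae pr
      by (intro lead_add lead_diff 1 2 lead_cmult) (auto intro: lead_ell lead_faster[OF lead_ell])
    moreover have "eventually (\<lambda>t. G t = 0) at_top" using F eventually_ge_at_top[of 0]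
    proof eventually_elim
      case (elim t)
      have "p * rem a b t = 1 / 2 * ell (a * t) - ln 2 / 2" "r * rem e f t = 1 / 2 * ell (e * t) - ln 2 / 2"
        using rem_0_eq[of a t] rem_0_eq[of e t] elim ae pr True z by (simp_all add: field_simps)
      with elim show ?case by (simp add: G_def dp_def)
    qed
    ultimately have "exp (- (2 * r * ((A + C) / 2))) = 1" using lead_eq_0 by fastforce
    then have "r * (A + C) = 0" by simp
    moreover have "A < 0" "C < 0" using True z ab ef by (simp_all add: A_def C_def)
    ultimately show False using pr by simp
  next
    case False
    with z ab ef have pos: "0 < b" "0 < f" by auto
    have dpm: "lead (dp s) (s + m) 1 (- (2 * s * ((x + y) / 2)))"
      if "lead (rem a b) m 1 x" "lead (rem e f) m 1 y" "0 < m" "0 < s" for s m x y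
    proof -
      have "lead \<epsilon> m 1 ((x + y) / 2)" unfolding \<epsilon>_def by (intro lead_divide lead_add that)
      from lead_ell_diff[OF this that(3,4), of 1] show ?thesis by (simp add: dp_def[abs_def])
    qed
    have key: "p * x = r * y"
      if m: "lead (rem a b) m i x" "lead (rem e f) m i y" "lead (rem a b) m 1 x'" "lead (rem e f) m 1 y'" "0 < m" for m i x y x' y'
    proof -
      have "lead (dp s) m i 0" if "0 < s" for s
        by (rule lead_faster[OF dpm[OF m(3-5) that]]) (use that in simp)
      then have "lead (\<lambda>t. p * rem a b t - r * rem e f t + dp p t - dp r t) m i (p * x - r * y + 0 - 0)"
        using pr by (intro lead_add lead_diff lead_cmult m(1,2)) auto
      from lead_eq_0[OF this F] show ?thesis by simp
    qed
    note a1 = lead_rem_pos_1[OF pos(1) ab(2)] and e1 = lead_rem_pos_1[OF pos(2) ef(2)]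
    note af = lead_rem_faster[OF pos(1) ab(2)] and ef' = lead_rem_faster[OF pos(2) ef(2)]
    have "\<not> b < f"
    proof
      assume "b < f"
      obtain j s where s: "s > 0" "lead (rem a b) b j (- s)" using lead_rem_pos[OF pos(1) ab(2)] by blast
      from key[OF s(2) ef'[OF \<open>b < f\<close>] a1 ef'[OF \<open>b < f\<close>] pos(1)] s pr show False by simp
    qed
    moreover have "\<not> f < b"
    proof
      assume "f < b"
      obtain j s where s: "s > 0" "lead (rem e f) f j (- s)" using lead_rem_pos[OF pos(2) ef(2)] by blast
      from key[OF af[OF \<open>f < b\<close>] s(2) af[OF \<open>f < b\<close>] e1 pos(2)] s pr show False by simp
    qed
    ultimately have bf: "f = b" by simp
    have e1': "lead (rem e f) b 1 (if e = b then - 2 else 0)" using e1 bf by simp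
    have "p * (if a = b then - 2 else 0) = r * (if e = b then - 2 else 0)"
      by (rule key[OF a1 e1' a1 e1' pos(1)])
    then have lt: "b < a" "b < e" using pr ab ef bf by (auto split: if_splits)
    note a0 = lead_rem_pos_0[OF pos(1) lt(1)]
    have e0: "lead (rem e f) b 0 (- (1 / (e - b)))" using lead_rem_pos_0[OF pos(1) lt(2)] bf by simp
    have "p * (- (1 / (a - b))) = r * (- (1 / (e - b)))"
      by (rule key[OF a0 e0 a1 e1' pos(1)])
    then have "p * (e - b) = r * (a - b)" using lt by (simp add: field_simps)
    moreover have "(a - b) - (e - b) = 2 * (p - r)" using sum bf by simp
    ultimately have "a - b = 2 * p \<and> e - b = 2 * r" using pr(2) by (intro double_of_proportional) simp_all
    then have ae: "a - b = 2 * p" "e - b = 2 * r" by blast+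
    \<comment> \<open>The values of \<open>a - b\<close> and \<open>e - b\<close> give both
      \<open>ell (b * t)\<close> terms the same weight, so they drop out. Since \<open>a\<close> and
      \<open>e\<close> exceed \<open>r + b\<close>, the leading term of \<open>dp r\<close> stands
      alone.\<close>
    define G where "G t = 1 / 2 * ell (a * t) - 1 / 2 * ell (e * t) + dp p t - dp r t" for t
    define c where "c = (- (1 / (a - b)) + - (1 / (e - b))) / 2"
    have "1 / (a - b) > 0" "1 / (e - b) > 0" using lt by simp_all
    then have c: "c < 0" unfolding c_def by argo
    have "lead \<epsilon> b 0 c" unfolding \<epsilon>_def c_def by (intro lead_divide lead_add a0 e0)
    from lead_ell_diff[OF this pos(1), of _ 1]
    have dpb: "lead (dp s) (s + b) 0 (- (2 * s * c))" if "0 < s" for s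
      using that by (simp add: dp_def[abs_def])
    have "lead (dp p) (r + b) 0 0" by (rule lead_faster[OF dpb]) (use pr in auto)
    then have "lead G (r + b) 0 (1 / 2 * 0 - 1 / 2 * 0 + 0 - - (2 * r * c))"
      unfolding G_def using ae pr pos ab ef dpb[OF pr(1)]
      by (intro lead_add lead_diff lead_cmult) (auto intro: lead_faster[OF lead_ell])
    moreover have "eventually (\<lambda>t. G t = 0) at_top" using F eventually_ge_at_top[of 0]
    proof eventually_elim
      case (elim t)
      have "rem a b t = (ell (a * t) - ell (b * t)) / (2 * p)" "rem e f t = (ell (e * t) - ell (b * t)) / (2 * r)"
        using rem_eq_ell[of a b t] rem_eq_ell[of e b t] elim pos lt unfolding ae bf by simp_all
      then have "p * rem a b t = (ell (a * t) - ell (b * t)) / 2" "r * rem e f t = (ell (e * t) - ell (b * t)) / 2"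
        using pr by simp_all
      with elim(1) show ?case unfolding G_def by argo
    qed
    ultimately have "1 / 2 * 0 - 1 / 2 * 0 + 0 - - (2 * r * c) = 0" by (rule lead_eq_0)
    with c pr show False by simp
  qed
qed

text \<open>The derivative has the sign of \<open>1 + exp z - z * exp z\<close>, and
  \<open>1 + exp z \<le> 2 * exp z\<close> for \<open>z \<ge> 0\<close>; hence the threshold
  2.\<close>

lemma z_div_exp_antimono:
  fixes x y :: real assumes "2 \<le> x" "x \<le> y"
  shows "y / (1 + exp y) \<le> x / (1 + exp x)"
proof -
  have "\<exists>D. ((\<lambda>z. z / (1 + exp z)) has_real_derivative D) (at z) \<and> D \<le> 0" if "x \<le> z" "z \<le> y" for z
  proof (intro exI conjI)
    have p: "1 + exp z \<noteq> 0" using exp_gt_zero[of z] by linarith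
    show "((\<lambda>z. z / (1 + exp z)) has_real_derivative (1 * (1 + exp z) - z * (0 + exp z)) / ((1 + exp z) * (1 + exp z))) (at z)"
      by (intro derivative_intros DERIV_exp p)
    have "exp z \<ge> 1" using that assms by simp
    moreover have "2 * exp z \<le> z * exp z" using that assms by (intro mult_right_mono) auto
    ultimately have "1 + exp z \<le> z * exp z" by linarith
    then have "1 * (1 + exp z) - z * (0 + exp z) \<le> 0" by simp
    then show "(1 * (1 + exp z) - z * (0 + exp z)) / ((1 + exp z) * (1 + exp z)) \<le> 0"
      by (intro divide_nonpos_nonneg) auto
  qed
  then show ?thesis by (rule DERIV_nonpos_imp_nonincreasing[OF assms(2)])
qed

text \<open>From \<open>1 / q\<close> on, \<open>2 * q * x\<close> is at least 2, so
  \<open>z_div_exp_antimono\<close> applies: on the diagonal to \<open>rem\<close> itself, elsewhere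
  to its derivative multiplied by \<open>t\<close>.\<close>

lemma rem_mono:
  assumes pq: "0 < q" "q \<le> p" and xy: "1 / q \<le> x" "x \<le> y"
  shows "rem p q x \<le> rem p q y"
proof (cases "p = q")
  case True
  have x: "0 < x" "1 \<le> q * x" using xy pq by (auto simp: field_simps intro: less_le_trans[of 0 "1 / q"])
  have "2 * q * y / (1 + exp (2 * q * y)) \<le> 2 * q * x / (1 + exp (2 * q * x))"
    using x xy pq by (intro z_div_exp_antimono) auto
  moreover have "rem p q t = - (2 * q * t / (1 + exp (2 * q * t))) / q" for t
    using True pq by (simp add: rem_diag)
  ultimately show ?thesis using pq by (simp only: minus_divide_left[symmetric] neg_le_iff_le divide_right_mono)
next
  case False
  with pq have lt: "q < p" by simp
  have pos: "0 < t" if "x \<le> t" for t using xy pq that less_le_trans[of 0 "1 / q" t] by simp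
  have "\<exists>D. ((\<lambda>t. (ell (p * t) - ell (q * t)) / (p - q)) has_real_derivative D) (at t) \<and> D \<ge> 0" if "x \<le> t" "t \<le> y" for t
  proof (intro exI conjI)
    have t: "0 < t" "1 \<le> q * t" using pos that xy pq by (auto simp: field_simps intro: order_trans)
    have d: "((\<lambda>t. ell (s * t)) has_real_derivative - (2 * s / (1 + exp (2 * s * t)))) (at t)" for s
    proof -
      have n: "1 + exp (- (2 * (s * t))) > 0" by (simp add: add_pos_pos)
      have "((\<lambda>t. ell (s * t)) has_real_derivative
        1 / (1 + exp (- (2 * (s * t)))) * (0 + exp (- (2 * (s * t))) * (- (2 * (s * 1))))) (at t)"
        unfolding ell_def using n
        by (auto intro!: derivative_eq_intros)
      moreover have "1 / (1 + inverse y) * (0 + inverse y * (- (2 * (s * 1)))) = - (2 * s / (1 + y))" if "y > 0" for y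
      proof -
        have "1 + inverse y = (1 + y) / y" "1 + y > 0" using that by (simp_all add: field_simps)
        then show ?thesis using that by simp
      qed
      from this[of "exp (2 * (s * t))"] 
      have "1 / (1 + exp (- (2 * (s * t)))) * (0 + exp (- (2 * (s * t))) * (- (2 * (s * 1)))) = - (2 * s / (1 + exp (2 * s * t)))"
        by (simp add: exp_minus mult.assoc)
      ultimately show ?thesis by simp
    qed
    show "((\<lambda>t. (ell (p * t) - ell (q * t)) / (p - q)) has_real_derivative
      (- (2 * p / (1 + exp (2 * p * t))) - - (2 * q / (1 + exp (2 * q * t)))) / (p - q)) (at t)"
      by (intro DERIV_cdivide DERIV_diff d)
    have "2 * p * t / (1 + exp (2 * p * t)) \<le> 2 * q * t / (1 + exp (2 * q * t))"
      using t pq by (intro z_div_exp_antimono) (auto intro: mult_right_mono)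
    then have "t * (2 * p / (1 + exp (2 * p * t))) \<le> t * (2 * q / (1 + exp (2 * q * t)))" by (simp add: mult_ac)
    then have "2 * p / (1 + exp (2 * p * t)) \<le> 2 * q / (1 + exp (2 * q * t))"
      using t(1) by (simp only: mult_le_cancel_left_pos)
    then show "(- (2 * p / (1 + exp (2 * p * t))) - - (2 * q / (1 + exp (2 * q * t)))) / (p - q) \<ge> 0"
      using lt by (intro divide_nonneg_pos) auto
  qed
  from DERIV_nonneg_imp_nondecreasing[OF xy(2) this]
  show ?thesis using pos[of x] pos[of y] xy pq lt by (simp add: rem_eq_ell)
qed

text \<open>The equation becomes \<open>rem a b t + rem p q (t + \<epsilon> t) = rem p q t\<close>.
  Since \<open>rem a b t\<close> and \<open>\<epsilon> t\<close> are negative, monotonicity makes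
  the left side too small.\<close>

lemma opposite_slopes_one:
  assumes inv: "log_invariant a b (- f) (- e) p q"
    and ab: "0 \<le> b" "b \<le> a" "0 < a" and ef: "0 \<le> f" "f \<le> e" "0 < e" and pq: "0 < q" "q \<le> p"
  shows False
proof -
  have sl: "slope a b = 1" "slope e f = 1" "slope p q = 1" using ab ef pq by (simp_all add: slope_eq_1)
  define \<epsilon> where "\<epsilon> t = (rem a b t + rem e f t) / 2" for t
  have "(\<epsilon> \<longlongrightarrow> ((if b = 0 then - (ln 2 / a) else 0) + (if f = 0 then - (ln 2 / e) else 0)) / 2) at_top"
    unfolding \<epsilon>_def by (intro tendsto_intros rem_tendsto ab ef) simp
  from filterlim_mult_add_at_top[OF this, of 1]
  have "eventually (\<lambda>t. 1 / q \<le> t + \<epsilon> t) at_top" by (simp add: filterlim_at_top)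
  with eventually_gt_at_top[of 0] have "eventually (\<lambda>t::real. False) at_top"
  proof eventually_elim
    case (elim t)
    have neg: "rem a b t < 0" "rem e f t < 0" using rem_neg sl elim by auto
    then have "rem p q (t + \<epsilon> t) \<le> rem p q t" using elim pq by (intro rem_mono) (auto simp: \<epsilon>_def)
    moreover have "(rem a b t - rem e f t) / 2 + (t + \<epsilon> t + rem p q (t + \<epsilon> t)) = t + rem p q t"
      using log_invariant_rem_opposite_slopes[OF inv sl(1,2), of t] by (simp add: log_gini_eq_rem sl \<epsilon>_def)
    ultimately show ?case using neg unfolding \<epsilon>_def by argo
  qed
  then show False by simp
qed

text \<open>The function \<open>2 ^ x - 1 - x\<close> is strictly convex and vanishes at 0 and 1. A
  third zero would give, by Rolle, two zeros of its injective derivative.\<close>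

lemma exp_eq_linear:
  fixes z :: real assumes "0 < z" "exp (z * ln 2) = 1 + z" shows "z = 1"
proof (rule ccontr)
  assume "z \<noteq> 1"
  define f where "f x = exp (x * ln 2) - 1 - x" for x :: real
  have f: "f 0 = 0" "f 1 = 0" "f z = 0" using assms by (simp_all add: f_def)
  have d: "(f has_real_derivative exp (x * ln 2) * ln 2 - 1) (at x)" for x
    unfolding f_def by (auto intro!: derivative_eq_intros)
  have rolle: "\<exists>x. u < x \<and> x < v \<and> exp (x * ln 2) * ln 2 - 1 = 0" if "u < v" "f u = 0" "f v = 0" for u v
  proof -
    from MVT2[OF \<open>u < v\<close> d] that show ?thesis by auto
  qed
  obtain u v w where uvw: "u < v" "v < w" "f u = 0" "f v = 0" "f w = 0"
  proof (cases "z < 1")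
    case True then show ?thesis using that[of 0 z 1] f assms by simp
  next
    case False then show ?thesis using that[of 0 1 z] f \<open>z \<noteq> 1\<close> by simp
  qed
  obtain x where x: "x < v" "exp (x * ln 2) * ln 2 - 1 = 0" using rolle uvw by blast
  obtain y where y: "v < y" "exp (y * ln 2) * ln 2 - 1 = 0" using rolle uvw by blast
  from x y have "exp (x * ln 2) * ln 2 = exp (y * ln 2) * ln (2::real)" by simp
  then have "exp (x * ln 2) = exp (y * ln (2::real))" by simp
  then have "x * ln 2 = y * ln (2::real)" unfolding exp_inj_iff .
  with x y show False by simp
qed

text \<open>The conclusion is the family with \<open>u = p\<close> and \<open>v = e\<close>. In
  \<open>E\<close> the second bracket carries the factor \<open>P\<close>, so exponents of the first
  pair are matched with those of the second pair increased by \<open>p\<close>.\<close>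

lemma opposite_slopes_power:
  assumes inv: "log_invariant a b (- f) (- e) p 0"
    and ab: "0 \<le> b" "b \<le> a" "0 < a" and ef: "0 \<le> f" "f \<le> e" "0 < e" and p: "0 < p"
  shows "a = p + e \<and> b = p + f \<and> e = p + f"
proof -
  have sl: "slope a b = 1" "slope e f = 1" using ab ef by (simp_all add: slope_eq_1)
  have sum: "a + b - e - f = 2 * p" using log_invariant_sum[OF inv] by simp
  define A C where "A = (if b = 0 then - (ln 2 / a) else 0)" and "C = (if f = 0 then - (ln 2 / e) else 0)"
  have A: "(rem a b \<longlongrightarrow> A) at_top" and C: "(rem e f \<longlongrightarrow> C) at_top"
    unfolding A_def C_def using rem_tendsto[OF ab] rem_tendsto[OF ef] by simp_all
  define P where "P t = exp (- (2 * p * t))" for t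
  define X Y where "X t = p * rem a b t" and "Y t = - p * rem e f t" for t
  have E: "(exp (X t) - 1) + P t * (exp (Y t) - 1) = 0" for t
  proof -
    have "log_gini (- f) (- e) t = - (t + rem e f t)"
      unfolding log_gini_minus log_gini_commute[of f e] by (simp add: log_gini_eq_rem sl)
    moreover have "log_gini a b t = t + rem a b t" by (simp add: log_gini_eq_rem sl)
    moreover have "exp (p * log_gini a b t) + exp (p * log_gini (- f) (- e) t) = 2 * cosh (p * t)"
      using inv p by (simp add: log_invariant_power_iff)
    ultimately have "exp (p * (t + rem a b t)) + exp (p * - (t + rem e f t)) = exp (p * t) + exp (- (p * t))"
      by (simp add: cosh_def)
    then have "exp (p * t) * (exp (X t) + P t * exp (Y t)) = exp (p * t) * (1 + P t)"
      by (simp add: X_def Y_def P_def algebra_simps flip: exp_add)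
    then have "exp (X t) + P t * exp (Y t) = 1 + P t" by (simp only: mult_left_cancel[OF exp_not_eq_zero])
    then show ?thesis by (simp add: algebra_simps)
  qed
  have E': "eventually (\<lambda>t. (exp (X t) - 1) + P t * (exp (Y t) - 1) = 0) at_top" by (simp add: E)
  have P: "lead P p 0 1" unfolding P_def by (rule lead_exp)
  have "((\<lambda>t. (exp (X t) - 1) + P t * (exp (Y t) - 1)) \<longlongrightarrow> (exp (p * A) - 1) + 0 * (exp (- p * C) - 1)) at_top"
    unfolding X_def Y_def by (intro tendsto_intros A C lead_tendsto[OF P p])
  from lead_eq_0[OF tendsto_leadD[OF this] E'] have "A = 0" using p by simp
  then have b: "0 < b" using ab by (auto simp: A_def split: if_splits)
  have X: "lead (\<lambda>t. exp (X t) - 1) m i (p * x)" if "lead (rem a b) m i x" "0 < m" for m i x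
    unfolding X_def using that by (intro lead_expm1 lead_cmult)
  have Xf: "lead (\<lambda>t. exp (X t) - 1) m i 0" if "m < b" for m i
    using X[OF lead_rem_pos_1[OF b ab(2)] b] that by (rule lead_faster)
  obtain j s where s: "s > 0" "lead (rem a b) b j (- s)" using lead_rem_pos[OF b ab(2)] by blast
  show ?thesis
  proof (cases "f = 0")
    case True
    \<comment> \<open>For \<open>f = 0\<close> the second remainder does not vanish in the limit, so
      the bracket contributes the constant \<open>2 ^ (p / e) - 1\<close>. It has to equal
      \<open>p / (a - b) = p / e\<close>.\<close>
    define K where "K = exp (p / e * ln 2) - 1"
    have K: "K > 0" using p ef by (simp add: K_def)
    have "((\<lambda>t. exp (Y t) - 1) \<longlongrightarrow> exp (- p * C) - 1) at_top"
      unfolding Y_def by (intro tendsto_intros C)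
    then have "lead (\<lambda>t. exp (Y t) - 1) 0 0 K" using True tendsto_leadD by (simp add: K_def C_def)
    from lead_mult[OF P this] have Y: "lead (\<lambda>t. P t * (exp (Y t) - 1)) p 0 K" by simp
    have "\<not> b < p"
    proof
      assume "b < p"
      from lead_eq_0[OF lead_add[OF X[OF s(2) b] lead_faster[OF Y this]] E'] s p show False by simp
    qed
    moreover have "\<not> p < b"
    proof
      assume "p < b"
      from lead_eq_0[OF lead_add[OF Xf[OF this] Y] E'] K show False by simp
    qed
    ultimately have bp: "b = p" by simp
    have "lead (\<lambda>t. P t * (exp (Y t) - 1)) b 1 0" using lead_Suc[OF Y] bp by simp
    from lead_eq_0[OF lead_add[OF X[OF lead_rem_pos_1[OF b ab(2)] b] this] E']
    have ba: "b < a" using ab p by (auto split: if_splits)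
    have "p * - (1 / (a - b)) + K = 0"
      using lead_eq_0[OF lead_add[OF X[OF lead_rem_pos_0[OF b ba] b] Y[folded bp]] E'] .
    moreover have ae: "a - b = e" using sum bp True by simp
    ultimately have "exp (p / e * ln 2) = 1 + p / e" by (simp add: K_def)
    then have "p / e = 1" using exp_eq_linear[of "p / e"] p ef by simp
    with ae bp True ef show ?thesis by simp
  next
    case False
    with ef have f: "0 < f" by simp
    have Y: "lead (\<lambda>t. P t * (exp (Y t) - 1)) (p + m) i (- p * x)" if "lead (rem e f) m i x" "0 < m" for m i x
      using lead_mult[OF P lead_expm1[OF lead_cmult[OF that(1), of "- p"] that(2)]] by (simp add: Y_def)
    have Yf: "lead (\<lambda>t. P t * (exp (Y t) - 1)) m i 0" if "m < p + f" for m i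
      using Y[OF lead_rem_pos_1[OF f ef(2)] f] that by (rule lead_faster)
    obtain j' s' where s': "s' > 0" "lead (rem e f) f j' (- s')" using lead_rem_pos[OF f ef(2)] by blast
    have "\<not> b < p + f"
    proof
      assume "b < p + f"
      from lead_eq_0[OF lead_add[OF X[OF s(2) b] Yf[OF this]] E'] s p show False by simp
    qed
    moreover have "\<not> p + f < b"
    proof
      assume "p + f < b"
      from lead_eq_0[OF lead_add[OF Xf[OF this] Y[OF s'(2) f]] E'] s' p show False by simp
    qed
    ultimately have bp: "b = p + f" by simp
    with sum have ap: "a = p + e" by simp
    \<comment> \<open>The leading terms cancel for all \<open>e\<close>, \<open>f\<close>; the condition \<open>e = p + f\<close> only shows at second order.\<close>
    have Pb: "P t * exp (- (2 * f * t)) = exp (- (2 * b * t))" "P t * exp (- (2 * e * t)) = exp (- (2 * a * t))" for t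
      by (simp_all add: P_def bp ap algebra_simps flip: exp_add)
    have fe: "f < e"
    proof (rule ccontr)
      assume "\<not> f < e"
      with ef have fe: "f = e" "b = a" using bp ap by simp_all
      \<comment> \<open>This is the equation \<open>E\<close> with the terms
        \<open>t * exp (- 2 * a * t)\<close> removed, which cancel by \<open>Pb\<close>. At exponent
        \<open>p + 2 * e\<close> only the square of \<open>Y\<close> reaches the factor
        \<open>t ^ 2\<close>, and nothing can compensate it.\<close>
      define U where "U t = (exp (X t) - 1 - X t) + p * (rem a a t + 2 * t * exp (- (2 * a * t))) +
        P t * ((exp (Y t) - 1 - Y t) - p * (rem e e t + 2 * t * exp (- (2 * e * t))))" for t
      have XX: "lead X a 1 (p * - 2)" unfolding X_def fe using ab by (intro lead_cmult lead_rem_diag)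
      have YY: "lead Y e 1 (- p * - 2)" unfolding Y_def fe using ef by (intro lead_cmult lead_rem_diag)
      have m: "p + 2 * e < 2 * a" using ap p by simp
      have 1: "lead (\<lambda>t. exp (X t) - 1 - X t) (p + 2 * e) 2 0"
        by (rule lead_faster[OF lead_expm1_2[OF XX ab(3)] m])
      have 2: "lead (\<lambda>t. rem a a t + 2 * t * exp (- (2 * a * t))) (p + 2 * e) 2 0"
        by (rule lead_faster[OF lead_rem_diag_2[OF ab(3)] m])
      have 3: "lead (\<lambda>t. exp (Y t) - 1 - Y t) (2 * e) 2 ((- p * - 2) ^ 2 / 2)"
        using lead_expm1_2[OF YY ef(3)] by simp
      have 4: "lead (\<lambda>t. rem e e t + 2 * t * exp (- (2 * e * t))) (2 * e) 2 0"
        using lead_Suc[OF lead_rem_diag_2[OF ef(3)]] by (simp add: numeral_2_eq_2)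
      have 5: "lead (\<lambda>t. P t * ((exp (Y t) - 1 - Y t) - p * (rem e e t + 2 * t * exp (- (2 * e * t))))) (p + 2 * e) 2
        ((- p * - 2) ^ 2 / 2 - p * 0)"
        using lead_mult[OF P lead_diff[OF 3 lead_cmult[OF 4, of p]]] by (simp only: add_0 mult_1)
      have "lead U (p + 2 * e) 2 (0 + p * 0 + ((- p * - 2) ^ 2 / 2 - p * 0))"
        unfolding U_def by (intro lead_add 1 lead_cmult 2 5)
      moreover have "U t = 0" for t
      proof -
        have "U t = (exp (X t) - 1) + P t * (exp (Y t) - 1) + p * (2 * t) * (exp (- (2 * a * t)) - P t * exp (- (2 * e * t)))"
          by (simp add: U_def X_def Y_def fe algebra_simps)
        then show ?thesis by (simp add: E Pb)
      qed
      ultimately have "0 + p * 0 + ((- p * - 2) ^ 2 / 2 - p * 0) = 0" using lead_eq_0 by fastforce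
      with p show False by simp
    qed
    then have ba: "b < a" using ap bp by simp
    \<comment> \<open>\<open>exp (Y t)\<close> is the \<open>n\<close>-th power of the quotient of
      \<open>1 + exp (- 2 * f * t)\<close> and \<open>1 + exp (- 2 * e * t)\<close>. The coefficient
      that survives at second order is the binomial coefficient
      \<open>n * (n - 1) / 2\<close>.\<close>
    define n where "n = p / (e - f)"
    have n: "n > 0" using p fe by (simp add: n_def)
    define L where "L m t = ell (m * t) - exp (- (2 * m * t))" for m t
    define U where "U t = (exp (X t) - 1 - X t) + n * L a t - n * L b t +
        P t * ((exp (Y t) - 1 - Y t) + n * L f t - n * L e t)" for t
    have L: "lead (L m) (2 * m) 0 (- (1 / 2))" if "0 < m" for m
      unfolding L_def using that by (rule lead_ell_2)
    have XX: "lead X b 0 (p * - (1 / (a - b)))" unfolding X_def using b ba by (intro lead_cmult lead_rem_pos_0)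
    have "lead Y f 0 (- p * - (1 / (e - f)))" unfolding Y_def using f fe by (intro lead_cmult lead_rem_pos_0)
    then have YY: "lead Y f 0 n" by (simp add: n_def)
    have m: "p + 2 * f < 2 * a" "p + 2 * f < 2 * b" "2 * f < 2 * e" using ap bp p fe by simp_all
    have 1: "lead (\<lambda>t. exp (X t) - 1 - X t) (p + 2 * f) 0 0"
      by (rule lead_faster[OF lead_expm1_2[OF XX b] m(2)])
    have 2: "lead (L a) (p + 2 * f) 0 0" by (rule lead_faster[OF L[OF ab(3)] m(1)])
    have 3: "lead (L b) (p + 2 * f) 0 0" by (rule lead_faster[OF L[OF b] m(2)])
    have 4: "lead (L e) (2 * f) 0 0" by (rule lead_faster[OF L[OF ef(3)] m(3)])
    have 5: "lead (\<lambda>t. exp (Y t) - 1 - Y t) (2 * f) 0 (n ^ 2 / 2)" using lead_expm1_2[OF YY f] by simp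
    have 6: "lead (\<lambda>t. P t * ((exp (Y t) - 1 - Y t) + n * L f t - n * L e t)) (p + 2 * f) 0
       (n ^ 2 / 2 + n * - (1 / 2) - n * 0)"
      using lead_mult[OF P lead_diff[OF lead_add[OF 5 lead_cmult[OF L[OF f], of n]] lead_cmult[OF 4, of n]]] by simp
    have "lead U (p + 2 * f) 0 (0 + n * 0 - n * 0 + (n ^ 2 / 2 + n * - (1 / 2) - n * 0))"
      unfolding U_def by (intro lead_add lead_diff lead_cmult 1 2 3 6)
    moreover have "eventually (\<lambda>t. U t = 0) at_top" using eventually_ge_at_top[of 0]
    proof eventually_elim
      case (elim t)
      have "a - b = e - f" using ap bp by simp
      then have XY: "X t = n * (ell (a * t) - ell (b * t))" "Y t = - n * (ell (e * t) - ell (f * t))"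
        using rem_eq_ell[of a b t] rem_eq_ell[of e f t] elim b f ba fe by (simp_all add: X_def Y_def n_def)
      have "U t = (exp (X t) - 1) + P t * (exp (Y t) - 1) - n * (exp (- (2 * a * t)) - P t * exp (- (2 * e * t)))
        + n * (exp (- (2 * b * t)) - P t * exp (- (2 * f * t)))"
      proof -
        have "(x - 1 - n * (A - B)) + n * (A - u) - n * (B - v) + P t * ((y - 1 - - n * (K - F)) + n * (F - w) - n * (K - z))
          = (x - 1) + P t * (y - 1) - n * (u - P t * z) + n * (v - P t * w)" for A B F K u v w x y z
          by (simp add: algebra_simps)
        then show ?thesis unfolding U_def L_def XY .
      qed
      then show ?case by (simp add: E Pb)
    qed
    ultimately have "0 + n * 0 - n * 0 + (n ^ 2 / 2 + n * - (1 / 2) - n * 0) = 0" by (rule lead_eq_0)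
    then have "n * (n - 1) = 0" by (simp add: power2_eq_square algebra_simps)
    with n have "n = 1" by simp
    with fe have "p = e - f" by (simp add: n_def field_simps)
    with ap bp show ?thesis by simp
  qed
qed

subsection \<open>Exactly one extremal slope\<close>

lemma lead_scale:
  assumes "lead f m j c" "0 < k"
  shows "lead (\<lambda>t. f (k * t)) (m * k) j (c * k ^ j)"
proof -
  have "filterlim (\<lambda>t. k * t) at_top at_top"
    using assms(2) by (intro filterlim_tendsto_pos_mult_at_top[OF tendsto_const _ filterlim_ident])
  from filterlim_compose[OF assms(1)[unfolded lead_def] this]
  have "((\<lambda>t. f (k * t) * exp (2 * m * (k * t)) / (k * t) ^ j * k ^ j) \<longlongrightarrow> c * k ^ j) at_top"
    by (intro tendsto_intros)
  then show ?thesis unfolding lead_def using assms(2) by (simp add: power_mult_distrib mult.assoc)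
qed

lemma rem_tendsto_inner:
  assumes "c + d = 0 \<or> d < 0 \<and> 0 < c"
  shows "(rem c d \<longlongrightarrow> 0) at_top"
proof (cases "c + d = 0")
  case True
  then have "rem c d = (\<lambda>t. 0)" by (auto simp: rem_opposite)
  then show ?thesis by simp
next
  case False
  with assms have cd: "d < 0" "0 < c" by auto
  have "((\<lambda>t. (ell (c * t) - ell (- d * t)) / (c - d)) \<longlongrightarrow> (0 - 0) / (c - d)) at_top"
    using cd lead_tendsto[OF lead_ell[of c]] lead_tendsto[OF lead_ell[of "- d"]]
    by (intro tendsto_intros) auto
  moreover have "eventually (\<lambda>t. (ell (c * t) - ell (- d * t)) / (c - d) = rem c d t) at_top"
    using eventually_ge_at_top[of 0] by eventually_elim (use cd in \<open>simp add: rem_eq_ell\<close>)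
  ultimately show ?thesis using Lim_transform_eventually by fastforce
qed

text \<open>The equation becomes
  \<open>rem a b t + rem p q (k * t + \<epsilon> t) = rem p q t\<close> with \<open>k < 1\<close>.
  The second summand is a negative term of slower decay than the right side, and
  \<open>rem a b\<close> is negative too.\<close>

lemma one_extremal_slope_pos:
  assumes inv: "log_invariant a b c d p q"
    and ab: "0 \<le> b" "b \<le> a" "0 < a" and pq: "0 < q" "q \<le> p"
    and cd: "c + d = 0 \<or> d < 0 \<and> 0 < c" "- 1 < slope c d" "slope c d < 1"
  shows False
proof -
  have sl: "slope a b = 1" "slope p q = 1" using ab pq by (simp_all add: slope_eq_1)
  define k where "k = (1 - slope c d) / 2"
  \<comment> \<open>Any number strictly between \<open>k\<close> and 1 would do: the surplus
    \<open>(k' - k) * t\<close> absorbs the bounded shift \<open>\<epsilon>\<close>, so that the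
    comparison is with a pure rescaling.\<close>
  define k' where "k' = (1 + k) / 2"
  have k: "0 < k" "k < k'" "k' < 1" using cd by (simp_all add: k_def k'_def field_simps)
  define \<epsilon> where "\<epsilon> t = (rem a b t - rem c d t) / 2" for t
  define A where "A = (if b = 0 then - (ln 2 / a) else 0)"
  have \<epsilon>: "(\<epsilon> \<longlongrightarrow> (A - 0) / 2) at_top"
    unfolding \<epsilon>_def A_def by (intro tendsto_intros rem_tendsto rem_tendsto_inner ab cd) simp
  have "eventually (\<lambda>t. 1 / q \<le> k * t + \<epsilon> t) at_top"
    using filterlim_mult_add_at_top[OF \<epsilon> k(1)] by (simp add: filterlim_at_top)
  moreover have "0 < k' - k" using k by simp
  from filterlim_mult_add_at_top[OF tendsto_minus[OF \<epsilon>] this]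
  have "eventually (\<lambda>t. 0 \<le> (k' - k) * t + - \<epsilon> t) at_top" unfolding filterlim_at_top by blast
  ultimately have "eventually (\<lambda>t. rem p q t - rem p q (k' * t) \<le> 0) at_top"
    using eventually_gt_at_top[of 0]
  proof eventually_elim
    case (elim t)
    have "k * t + \<epsilon> t \<le> k' * t" using elim by (simp add: algebra_simps)
    then have "rem p q (k * t + \<epsilon> t) \<le> rem p q (k' * t)" using elim pq by (intro rem_mono) auto
    moreover have "rem a b t < 0" using rem_neg[OF sl(1)] elim by simp
    moreover have "rem a b t + rem p q (k * t + \<epsilon> t) = rem p q t"
    proof -
      have "(log_gini a b t - log_gini c d t) / 2 = k * t + \<epsilon> t"
        by (simp add: log_gini_eq_rem[of a] log_gini_eq_rem[of c] sl k_def \<epsilon>_def field_simps)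
      with log_invariantD[OF inv, of t]
      have "(log_gini a b t + log_gini c d t) / 2 + log_gini p q (k * t + \<epsilon> t) = log_gini p q t" by simp
      then show ?thesis by (simp add: log_gini_eq_rem sl k_def \<epsilon>_def field_simps)
    qed
    ultimately show ?case by linarith
  qed
  moreover obtain j s where s: "s > 0" "lead (rem p q) q j (- s)" using lead_rem_pos[OF pq] by blast
  have "lead (\<lambda>t. rem p q t - rem p q (k' * t)) (q * k') j (0 - - s * k' ^ j)"
    using k pq by (intro lead_diff lead_scale s lead_rem_faster) auto
  ultimately have "0 - - s * k' ^ j \<le> 0" using lead_nonpos by blast
  moreover have "s * k' ^ j > 0" using s k by simp
  ultimately show False by simp
qed

text \<open>In \<open>E\<close> the slowest exponentials are those with exponents \<open>b\<close>
  and \<open>p * k\<close>; their cancellation gives \<open>b = p * k\<close> and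
  \<open>a = p + b\<close>. Then \<open>c + d\<close> equals \<open>p\<close> times the slope of
  \<open>c\<close> and \<open>d\<close>, an equation that splits into \<open>c + d = 0\<close> and
  \<open>c - d = p\<close>, one for each family.\<close>

lemma one_extremal_slope_power:
  assumes inv: "log_invariant a b c d p 0"
    and ab: "0 \<le> b" "b \<le> a" "0 < a" and p: "0 < p"
    and cd: "c + d = 0 \<or> d < 0 \<and> 0 < c" "- 1 < slope c d" "slope c d < 1"
  shows "(c + d = 0 \<and> p = 2 * b \<and> a = 3 * b) \<or> (a = p + b \<and> c = p - b \<and> d = - b)"
proof -
  have sl: "slope a b = 1" using ab by (simp add: slope_eq_1)
  have sum: "a + b + c + d = 2 * p" using log_invariant_sum[OF inv] by simp
  define k where "k = (1 - slope c d) / 2"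
  have k: "0 < k" "k < 1" and sc: "slope c d = 1 - 2 * k" using cd by (simp_all add: k_def field_simps)
  define A where "A = (if b = 0 then - (ln 2 / a) else 0)"
  have A: "(rem a b \<longlongrightarrow> A) at_top" unfolding A_def using rem_tendsto[OF ab] .
  have C: "(rem c d \<longlongrightarrow> 0) at_top" using rem_tendsto_inner cd by simp
  have E: "exp (p * rem a b t) - 1 + exp (- (2 * (p * k) * t)) * exp (p * rem c d t) - exp (- (2 * p * t)) = 0" for t
  proof -
    have "exp (p * log_gini a b t) + exp (p * log_gini c d t) = 2 * cosh (p * t)"
      using inv p by (simp add: log_invariant_power_iff)
    then have "exp (p * (t + rem a b t)) + exp (p * ((1 - 2 * k) * t + rem c d t)) = exp (p * t) + exp (- (p * t))"
      by (simp add: log_gini_eq_rem sl sc cosh_def)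
    then have "exp (p * t) * (exp (p * rem a b t) + exp (- (2 * (p * k) * t)) * exp (p * rem c d t))
        = exp (p * t) * (1 + exp (- (2 * p * t)))"
      by (simp add: algebra_simps flip: exp_add)
    then have "exp (p * rem a b t) + exp (- (2 * (p * k) * t)) * exp (p * rem c d t) = 1 + exp (- (2 * p * t))"
      by (simp only: mult_left_cancel[OF exp_not_eq_zero])
    then show ?thesis by simp
  qed
  have E': "eventually (\<lambda>t. exp (p * rem a b t) - 1 + exp (- (2 * (p * k) * t)) * exp (p * rem c d t) - exp (- (2 * p * t)) = 0) at_top"
    by (simp add: E)
  have "((\<lambda>t. exp (p * rem c d t)) \<longlongrightarrow> exp (p * 0)) at_top" by (intro tendsto_intros C)
  then have C': "lead (\<lambda>t. exp (p * rem c d t)) 0 0 1" using tendsto_leadD by simp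
  have Y: "lead (\<lambda>t. exp (- (2 * (p * k) * t)) * exp (p * rem c d t)) (p * k) 0 1"
    using lead_mult[OF lead_exp C'] by simp
  have Pf: "lead (\<lambda>t. exp (- (2 * p * t))) m i 0" if "m < p" for m i
    by (rule lead_faster[OF lead_exp that])
  have pk: "0 < p * k" "p * k < p" using p k by simp_all
  have "((\<lambda>t. exp (p * rem a b t) - 1 + exp (- (2 * (p * k) * t)) * exp (p * rem c d t) - exp (- (2 * p * t)))
     \<longlongrightarrow> exp (p * A) - 1 + 0 - 0) at_top"
    by (intro tendsto_intros A lead_tendsto[OF Y] lead_tendsto[OF lead_exp] pk p)
  from lead_eq_0[OF tendsto_leadD[OF this] E'] have "A = 0" using p by simp
  then have b: "0 < b" using ab by (auto simp: A_def split: if_splits)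
  have X: "lead (\<lambda>t. exp (p * rem a b t) - 1) m i (p * x)" if "lead (rem a b) m i x" "0 < m" for m i x
    using that by (intro lead_expm1 lead_cmult)
  have Xf: "lead (\<lambda>t. exp (p * rem a b t) - 1) m i 0" if "m < b" for m i
    using X[OF lead_rem_pos_1[OF b ab(2)] b] that by (rule lead_faster)
  obtain j s where s: "s > 0" "lead (rem a b) b j (- s)" using lead_rem_pos[OF b ab(2)] by blast
  have "\<not> b < p * k"
  proof
    assume "b < p * k"
    then have "b < p" using pk by simp
    from lead_eq_0[OF lead_diff[OF lead_add[OF X[OF s(2) b] lead_faster[OF Y \<open>b < p * k\<close>]] Pf[OF this]] E'] s p
    show False by simp
  qed
  moreover have "\<not> p * k < b"
  proof
    assume "p * k < b"
    from lead_eq_0[OF lead_diff[OF lead_add[OF Xf[OF this] Y] Pf[OF pk(2)]] E'] show False by simp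
  qed
  ultimately have bp: "b = p * k" by simp
  have bp': "b < p" using bp pk by simp
  have "lead (\<lambda>t. exp (- (2 * (p * k) * t)) * exp (p * rem c d t)) b 1 0" using lead_Suc[OF Y] bp by simp
  from lead_eq_0[OF lead_diff[OF lead_add[OF X[OF lead_rem_pos_1[OF b ab(2)] b] this] Pf[OF bp']] E']
  have ba: "b < a" using ab p by (auto split: if_splits)
  have "p * - (1 / (a - b)) + 1 - 0 = 0"
    by (rule lead_eq_0[OF lead_diff[OF lead_add[OF X[OF lead_rem_pos_0[OF b ba] b] Y[folded bp]] Pf[OF bp']] E'[folded bp]])
  then have a: "a = p + b" using ba by (simp add: field_simps)
  show ?thesis
  proof (cases "c + d = 0")
    case True
    with sum a show ?thesis by simp
  next
    case False
    with cd have cd': "d < 0" "0 < c" by auto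
    have cds: "c + d = p - 2 * b" using sum a by simp
    also have "\<dots> = p * slope c d" using bp by (simp add: k_def algebra_simps)
    also have "\<dots> = p * ((c + d) / (c - d))" by (simp add: slope_mixed[OF cd'])
    finally have "c + d = p * ((c + d) / (c - d))" .
    then have "(c + d) * (c - d) = p * (c + d)" using cd' by (simp add: field_simps)
    then have "c - d = p" using False by simp
    with cds a show ?thesis by simp
  qed
qed

subsection \<open>No extremal slope\<close>

lemma ell_antimono: "x \<le> y \<Longrightarrow> ell y \<le> ell x"
  by (simp add: ell_def add_pos_pos)

text \<open>Arithmetic for the last case of \<open>inner_slopes_contradiction\<close>. There
  \<open>c = w * r\<close>, \<open>g = (1 - w) * r\<close> and \<open>\<kappa> = w\<close>, so the
  claims are \<open>b < 2 * c\<close>, and \<open>p * \<kappa> < b\<close> whenever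
  \<open>p * \<kappa> \<le> g\<close>.\<close>

lemma inner_exponents:
  fixes b p r w :: real
  assumes w: "1 / 3 < w" "w < 1 / 2" and r: "0 < r"
    and p: "p * (1 - 2 * w) = r * w" and b: "(4 * w - 1) * b = r * (4 * w ^ 2 + 2 * w - 1)"
  shows "b < 2 * (w * r)" "p * w \<le> (1 - w) * r \<Longrightarrow> p * w < b"
proof -
  have pos: "0 < 4 * w - 1" "0 < 1 - 2 * w" using w by simp_all
  have "(2 * w - 1) ^ 2 > 0" using w by simp
  then have "0 < r * (2 * w - 1) ^ 2" using r by simp
  then have "(4 * w - 1) * b < (4 * w - 1) * (2 * (w * r))"
    unfolding b by (simp add: power2_eq_square algebra_simps)
  then show "b < 2 * (w * r)" using pos by simp
  assume "p * w \<le> (1 - w) * r"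
  then have "(p * w) * (1 - 2 * w) \<le> ((1 - w) * r) * (1 - 2 * w)" using pos by (intro mult_right_mono) auto
  moreover have pw: "(p * w) * (1 - 2 * w) = r * w ^ 2" using p by algebra
  ultimately have "0 \<le> r * (w ^ 2 - 3 * w + 1)" by (simp add: power2_eq_square algebra_simps)
  then have q: "0 \<le> w ^ 2 - 3 * w + 1" using r by (simp add: zero_le_mult_iff)
  \<comment> \<open>The smaller root of \<open>w ^ 2 - 3 * w + 1\<close> is 0.3819..., the positive
    root of \<open>4 * w ^ 2 + w - 1\<close> is 0.3903...; 0.385 is a rational number between them,
    and 2.615 is its complement to 3.\<close>
  have "w < 385 / 1000"
  proof (rule ccontr)
    assume "\<not> w < 385 / 1000"
    then have "0 \<le> (w - 385 / 1000) * (2615 / 1000 - w)" using w by (intro mult_nonneg_nonneg) auto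
    moreover have "(w - 385 / 1000) * (2615 / 1000 - w) = 3 * w - w ^ 2 - 1006775 / 1000000" by algebra
    ultimately show False using q by linarith
  qed
  then have "4 * w ^ 2 + w - 1 < 0" using w mult_strict_mono[of w "385 / 1000" w "385 / 1000"]
    by (simp add: power2_eq_square)
  \<comment> \<open>Up to the factor \<open>r\<close> this product is the difference of the two
    sides of the goal after multiplication by \<open>(4 * w - 1) * (1 - 2 * w)\<close>.\<close>
  then have "(3 * w - 1) * (4 * w ^ 2 + w - 1) < 0" using w by (intro mult_pos_neg) auto
  then have "r * ((3 * w - 1) * (4 * w ^ 2 + w - 1)) < 0" by (rule mult_pos_neg[OF r])
  then have "r * w ^ 2 * (4 * w - 1) < r * (4 * w ^ 2 + 2 * w - 1) * (1 - 2 * w)"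
    by (simp add: power2_eq_square algebra_simps)
  then have "(p * w) * ((4 * w - 1) * (1 - 2 * w)) < b * ((4 * w - 1) * (1 - 2 * w))"
    unfolding pw[symmetric] b[symmetric] by (simp add: mult_ac)
  then show "p * w < b" using pos by (simp only: mult_less_cancel_right_pos mult_pos_pos)
qed

lemma inner_slopes_contradiction:
  assumes inv: "log_invariant a (- b) c d p (- r)"
    and ab: "0 < b" "b < a" and cd: "c + d = 0 \<or> d < 0 \<and> 0 < c" and pr: "0 < r" "r < p"
    and sl: "slope c d < slope a (- b)" "- 1 < slope c d"
  shows False
proof -
  define \<kappa> where "\<kappa> = (slope a (- b) - slope c d) / 2"
  have slab: "slope a (- b) = (a - b) / (a + b)" "slope p (- r) = (p - r) / (p + r)"
    using ab pr by (simp_all add: slope_mixed)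
  have "slope a (- b) < 1" using ab by (simp add: slab)
  then have \<kappa>: "0 < \<kappa>" "\<kappa> < 1" using sl by (simp_all add: \<kappa>_def)
  define \<epsilon> where "\<epsilon> t = (rem a (- b) t - rem c d t) / 2" for t
  have "(\<epsilon> \<longlongrightarrow> (0 - 0) / 2) at_top"
    unfolding \<epsilon>_def using ab by (intro tendsto_intros rem_tendsto_inner cd) auto
  then have \<epsilon>: "(\<epsilon> \<longlongrightarrow> 0) at_top" by simp
  have sum: "a - b + c + d = 2 * (p - r)" using log_invariant_sum[OF inv] by simp
  have slope_eq: "(p + r) * ((slope a (- b) + slope c d) / 2) + (p - r) * \<kappa> = p - r"
  proof -
    have "(slope a (- b) + slope c d) / 2 + slope p (- r) * \<kappa> = slope p (- r)"
      using log_invariant_slope[OF inv] sl by (simp add: \<kappa>_def)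
    moreover have "(p + r) * slope p (- r) = p - r" using slab(2) pr by simp
    ultimately show ?thesis by (metis distrib_left mult.assoc)
  qed
  define Q where "Q s t = ell (s * (\<kappa> * t + \<epsilon> t))" for s t
  have F: "eventually (\<lambda>t. p * rem a (- b) t + r * rem c d t + Q p t - Q r t - ell (p * t) + ell (r * t) = 0) at_top"
  proof -
    have "eventually (\<lambda>t. 0 \<le> \<kappa> * t + \<epsilon> t) at_top"
      using filterlim_mult_add_at_top[OF \<epsilon> \<kappa>(1)] by (simp add: filterlim_at_top)
    with eventually_ge_at_top[of 0] show ?thesis
    proof eventually_elim
      case (elim t)
      define k1 k2 x y where "k1 = slope a (- b)" and "k2 = slope c d" and "x = rem a (- b) t" and "y = rem c d t"
      have "(log_gini a (- b) t - log_gini c d t) / 2 = \<kappa> * t + \<epsilon> t"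
        by (simp add: log_gini_eq_rem[of a] log_gini_eq_rem[of c] \<kappa>_def \<epsilon>_def field_simps)
      with log_invariantD[OF inv, of t]
      have "(k1 * t + x + (k2 * t + y)) / 2 + log_gini p (- r) (\<kappa> * t + \<epsilon> t) = log_gini p (- r) t"
        unfolding k1_def k2_def x_def y_def log_gini_eq_rem[symmetric] by simp
      then have "(p + r) * ((k1 * t + x + (k2 * t + y)) / 2) + (p + r) * log_gini p (- r) (\<kappa> * t + \<epsilon> t)
          = (p + r) * log_gini p (- r) t"
        unfolding distrib_left[symmetric] by simp
      moreover have "(p + r) * log_gini p (- r) (\<kappa> * t + \<epsilon> t) = (p - r) * (\<kappa> * t + \<epsilon> t) + Q p t - Q r t"
        using elim pr unfolding Q_def by (intro log_gini_mixed_eq) auto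
      moreover have "(p + r) * log_gini p (- r) t = (p - r) * t + ell (p * t) - ell (r * t)"
        using elim pr by (intro log_gini_mixed_eq) auto
      moreover have "(p + r) * ((k1 * t + x + (k2 * t + y)) / 2) + (p - r) * (\<kappa> * t + \<epsilon> t)
         = ((p + r) * ((k1 + k2) / 2) + (p - r) * \<kappa>) * t + (p * x + r * y)"
        by (simp add: \<epsilon>_def x_def y_def field_simps)
      then have "(p + r) * ((k1 * t + x + (k2 * t + y)) / 2) + (p - r) * (\<kappa> * t + \<epsilon> t) = (p - r) * t + (p * x + r * y)"
        using slope_eq unfolding k1_def[symmetric] k2_def[symmetric] by simp
      ultimately show ?case unfolding x_def[symmetric] y_def[symmetric] by linarith
    qed
  qed
  have Q: "lead (Q s) (s * \<kappa>) 0 1" if "0 < s" for s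
    using lead_ell_shift[OF \<epsilon> that \<kappa>(1)] by (simp add: Q_def[abs_def])
  have Qf: "lead (Q s) m i 0" if "0 < s" "m < s * \<kappa>" for s m i
    using Q[OF that(1)] that(2) by (rule lead_faster)
  have pk: "r * \<kappa> < p * \<kappa>" "r * \<kappa> < r" "0 < r * \<kappa>" using pr \<kappa> by simp_all
  have rest: "lead (\<lambda>t. ell (s * t)) m i 0" if "m < s" "0 \<le> m" for m s i
    using lead_faster[OF lead_ell] that by simp
  have rem_nonpos: "rem x (- y) t \<le> 0" if "0 < y" "y \<le> x" "0 \<le> t" for x y t
    using rem_eq_ell[of x "- y" t] that ell_antimono[of "y * t" "x * t"]
    by (simp add: divide_nonpos_nonneg mult_right_mono)
  \<comment> \<open>\<open>Q r\<close> enters with a minus sign and decays more slowly than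
    \<open>Q p\<close>, \<open>ell (p * t)\<close> and \<open>ell (r * t)\<close>. As
    \<open>rem a (- b)\<close> is not positive either, \<open>rem c d\<close> must be positive
    somewhere, which fixes the signs of \<open>c\<close>, \<open>d\<close> and
    \<open>c + d\<close>.\<close>
  have "d < 0 \<and> 0 < c \<and> c < - d"
  proof (rule ccontr)
    assume n: "\<not> ?thesis"
    have "lead (\<lambda>t. Q p t - Q r t - ell (p * t) + ell (r * t)) (r * \<kappa>) 0 (0 - 1 - 0 + 0)"
      using pk pr less_trans[OF pk(2) pr(2)] by (intro lead_add lead_diff Q Qf rest) auto
    moreover have "eventually (\<lambda>t. Q p t - Q r t - ell (p * t) + ell (r * t) \<ge> 0) at_top"
      using F eventually_ge_at_top[of 0]
    proof eventually_elim
      case (elim t)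
      have "rem a (- b) t \<le> 0" using rem_nonpos ab elim by simp
      moreover have "rem c d t \<le> 0"
        using n cd rem_nonpos[of "- d" c t] elim by (cases "c + d = 0") (auto simp: rem_opposite)
      ultimately have "p * rem a (- b) t \<le> 0" "r * rem c d t \<le> 0" using pr by (simp_all add: mult_nonneg_nonpos)
      with elim(1) show ?case by linarith
    qed
    ultimately have "0 \<le> 0 - 1 - 0 + (0::real)" by (rule lead_nonneg)
    then show False by simp
  qed
  moreover define g where "g = - d"
  ultimately have cg: "d = - g" "0 < c" "c < g" by auto
  have A: "lead (rem a (- b)) b 0 (- (1 / (a + b)))" using lead_rem[of "- b" a] ab by simp
  have Af: "lead (rem a (- b)) m i 0" if "m < b" for m i using A that by (rule lead_faster)
  have "rem c d t = - rem g (- c) t" for t using rem_minus[of g "- c" t] rem_commute[of c d t] cg by simp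
  then have remcd: "rem c d = (\<lambda>t. - rem g (- c) t)" by auto
  have C: "lead (rem c d) c 0 (1 / (c + g))"
    using lead_minus[OF lead_rem[of "- c" g]] cg unfolding remcd by (simp add: add.commute)
  have Cf: "lead (rem c d) m i 0" if "m < c" for m i using C that by (rule lead_faster)
  define u w where "u = b / (a + b)" and "w = c / (c + g)"
  have slcd: "slope c d = 2 * w - 1" "slope a (- b) = 1 - 2 * u"
    unfolding slab using slope_mixed[of d c] cg ab by (simp_all add: u_def w_def field_simps)
  have \<kappa>_eq: "\<kappa> = 1 - u - w" by (simp add: \<kappa>_def slcd)
  have "(slope a (- b) + slope c d) / 2 = w - u" by (simp add: slcd)
  from slope_eq[unfolded this \<kappa>_eq] have S: "p * u = r * w" by (simp add: algebra_simps)
  have coeff: "p * x + r * y + z - z' = 0"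
    if "lead (rem a (- b)) m 0 x" "lead (rem c d) m 0 y" "lead (Q p) m 0 z" "lead (Q r) m 0 z'" "0 < m" "m \<le> r * \<kappa>" for m x y z z'
  proof -
    have m: "m < r" "m < p" using that(6) pk(2) pr(2) by linarith+
    have "lead (\<lambda>t. p * rem a (- b) t + r * rem c d t + Q p t - Q r t - ell (p * t) + ell (r * t)) m 0 (p * x + r * y + z - z' - 0 + 0)"
      using that m by (intro lead_add lead_diff lead_cmult rest) auto
    from lead_eq_0[OF this F] show ?thesis by simp
  qed
  have cpos: "0 < p * (1 / (a + b))" "0 < r * (1 / (c + g))" using pr ab cg by simp_all
  have 1: "\<not> (c < b \<and> c < r * \<kappa>)"
  proof
    assume h: "c < b \<and> c < r * \<kappa>"
    then have "p * 0 + r * (1 / (c + g)) + 0 - 0 = 0"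
      using pk pr cg by (intro coeff[OF Af C Qf Qf]) auto
    with cpos show False by linarith
  qed
  have 2: "\<not> (r * \<kappa> < c \<and> r * \<kappa> \<le> b)"
  proof
    assume h: "r * \<kappa> < c \<and> r * \<kappa> \<le> b"
    have "\<exists>x\<le>0. lead (rem a (- b)) (r * \<kappa>) 0 x"
    proof (cases "r * \<kappa> = b")
      case True then show ?thesis using A ab by (intro exI[of _ "- (1 / (a + b))"]) simp
    next
      case False then show ?thesis using Af[of "r * \<kappa>" 0] h by (intro exI[of _ 0]) simp
    qed
    then obtain x where x: "x \<le> 0" "lead (rem a (- b)) (r * \<kappa>) 0 x" by blast
    have "p * x + r * 0 + 0 - 1 = 0"
      using h pk pr by (intro coeff[OF x(2) Cf Qf Q]) auto
    moreover have "p * x \<le> 0" using x pr by (simp add: mult_nonneg_nonpos)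
    ultimately show False by linarith
  qed
  have 3: "\<not> (b < c \<and> b \<le> r * \<kappa>)"
  proof
    assume h: "b < c \<and> b \<le> r * \<kappa>"
    have "\<exists>x\<ge>0. lead (Q r) b 0 x"
    proof (cases "r * \<kappa> = b")
      case True then show ?thesis using Q[OF pr(1)] by (intro exI[of _ 1]) simp
    next
      case False then show ?thesis using Qf[OF pr(1), of b 0] h by (intro exI[of _ 0]) simp
    qed
    then obtain x where x: "x \<ge> 0" "lead (Q r) b 0 x" by blast
    have "p * - (1 / (a + b)) + r * 0 + 0 - x = 0"
      using h pk pr ab by (intro coeff[OF A Cf Qf x(2)]) auto
    with x cpos show False by linarith
  qed
  \<comment> \<open>Of the slowest candidates only the one with exponent \<open>c\<close> is
    positive, so it must tie with the smaller of \<open>b\<close> and \<open>r * \<kappa>\<close>.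
    If all three tie, \<open>S2\<close> cancels two of them and \<open>Q r\<close> is left. If
    \<open>c = b\<close> alone, the \<open>ell (b * t)\<close> terms cancel exactly and the slowest
    term left, with exponent \<open>g\<close> or \<open>r * \<kappa>\<close>, is negative.\<close>
  consider "c = b" "c = r * \<kappa>" | "c = b" "c < r * \<kappa>" | "c < b" "c = r * \<kappa>" using 1 2 3 by linarith
  moreover have S2: "p / (a + b) = r / (c + g)" if "c = b"
  proof -
    have "b * (p / (a + b)) = b * (r / (c + g))" using S that by (simp add: u_def w_def mult_ac)
    moreover have "b \<noteq> 0" using ab by simp
    ultimately show ?thesis by (metis mult_left_cancel)
  qed
  ultimately show False
  proof cases
    case 1
    have "r * (1 / (c + g)) = p * (1 / (a + b))" using S2[OF 1(1)] by simp
    moreover have "p * - (1 / (a + b)) + r * (1 / (c + g)) + 0 - 1 = 0"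
      using 1 pk pr cg A Q[OF pr(1)] by (intro coeff[OF _ C Qf]) auto
    ultimately show False by linarith
  next
    case 2
    define \<mu> where "\<mu> = p / (a + b)"
    have \<mu>: "\<mu> = r / (c + g)" unfolding \<mu>_def by (rule S2[OF 2(1)])
    have \<mu>_pos: "0 < \<mu>" unfolding \<mu>_def using ab pr by (intro divide_pos_pos) auto
    have ga: "g < a" using sum cg 2 pr by simp
    define m where "m = min g (r * \<kappa>)"
    have m: "m \<le> g" "m \<le> r * \<kappa>" "0 < m" "m = g \<or> m = r * \<kappa>" using cg pk by (auto simp: m_def)
    obtain x where x: "lead (\<lambda>t. ell (g * t)) m 0 x" "0 \<le> x" "m = g \<Longrightarrow> x = 1"
      using lead_ell[of g] rest[of m g 0] m by (cases "m = g") fastforce+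
    obtain y where y: "lead (Q r) m 0 y" "0 \<le> y" "m = r * \<kappa> \<Longrightarrow> y = 1"
      using Q[OF pr(1)] Qf[OF pr(1), of m 0] m by (cases "m = r * \<kappa>") fastforce+
    have "lead (\<lambda>t. \<mu> * ell (a * t) - \<mu> * ell (g * t) + Q p t - Q r t - ell (p * t) + ell (r * t)) m 0
       (\<mu> * 0 - \<mu> * x + 0 - y - 0 + 0)"
    proof -
      have "m < r" "m < p" "m < p * \<kappa>" "m < a" using m(1,2) pk pr(2) ga by linarith+
      then show ?thesis using m(3) pr by (intro lead_add lead_diff lead_cmult x y rest Qf) auto
    qed
    moreover have "eventually (\<lambda>t. \<mu> * ell (a * t) - \<mu> * ell (g * t) + Q p t - Q r t - ell (p * t) + ell (r * t) = 0) at_top"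
      using F eventually_ge_at_top[of 0]
    proof eventually_elim
      case (elim t)
      have "p * rem a (- b) t = \<mu> * (ell (a * t) - ell (b * t))"
        using rem_eq_ell[of a "- b" t] elim ab by (simp add: \<mu>_def)
      moreover have "r * rem c d t = \<mu> * (ell (b * t) - ell (g * t))"
        using rem_eq_ell[of c d t] elim cg 2 by (simp add: \<mu>)
      ultimately show ?case using elim(1) by (simp add: algebra_simps)
    qed
    ultimately have "\<mu> * 0 - \<mu> * x + 0 - y - 0 + 0 = 0" by (rule lead_eq_0)
    moreover have "0 \<le> \<mu> * x" using \<mu>_pos x by simp
    ultimately have "\<mu> * x = 0" "y = 0" using y by linarith+
    with m x y \<mu>_pos show False by auto
  next
    case 3
    have "p * 0 + r * (1 / (c + g)) + 0 - 1 = 0"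
    proof -
      have "lead (Q r) c 0 1" using Q[OF pr(1)] 3(2) by simp
      moreover have "lead (Q p) c 0 0" using 3(2) pk(1) pr by (intro Qf) linarith+
      ultimately show ?thesis by (rule coeff[OF Af[OF 3(1)] C _ _ cg(2) eq_refl[OF 3(2)], rotated])
    qed
    then have r: "r = c + g" using cg by (simp add: field_simps)
    have "\<kappa> = c / r" using 3(2) pr by simp
    then have \<kappa>w: "\<kappa> = w" unfolding w_def r[symmetric] .
    with \<kappa>_eq have u: "u = 1 - 2 * w" by simp
    have c: "c = w * r" using 3(2) \<kappa>w by simp
    then have g: "g = (1 - w) * r" using r by (simp add: algebra_simps)
    have "u > 0" using ab by (simp add: u_def)
    then have w2: "w < 1 / 2" using u by simp
    have S': "p * (1 - 2 * w) = r * w" using S u by simp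
    have "r * (1 - 2 * w) < p * (1 - 2 * w)" using pr w2 by simp
    then have "r * (1 - 2 * w) < r * w" using S' by simp
    then have w1: "1 / 3 < w" using pr by simp
    have b: "(4 * w - 1) * b = r * (4 * w ^ 2 + 2 * w - 1)"
    proof -
      have b1: "b = (1 - 2 * w) * (a + b)" using ab u by (simp add: u_def field_simps)
      then have "a - b = (4 * w - 1) * (a + b)" by (simp add: algebra_simps)
      moreover have "a - b = 2 * (p - r) + (1 - 2 * w) * r" using sum cg c g by (simp add: algebra_simps)
      ultimately have e: "(4 * w - 1) * (a + b) = 2 * (p - r) + (1 - 2 * w) * r" by simp
      have "(4 * w - 1) * b = (1 - 2 * w) * ((4 * w - 1) * (a + b))" by (subst (1) b1) (simp only: mult_ac)
      also have "\<dots> = 2 * (p * (1 - 2 * w)) - 2 * r * (1 - 2 * w) + (1 - 2 * w) ^ 2 * r"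
        unfolding e by (simp add: power2_eq_square algebra_simps)
      also have "\<dots> = r * (4 * w ^ 2 + 2 * w - 1)"
        unfolding S' by (simp add: power2_eq_square algebra_simps)
      finally show ?thesis .
    qed
    \<comment> \<open>For fixed \<open>r\<close>, all other parameters are now functions of \<open>w\<close>, and the terms \<open>ell (c * t)\<close>, \<open>Q r t\<close>
      cancel to first order. The next exponents are \<open>g\<close> and \<open>b\<close> with negative and \<open>p * \<kappa>\<close> with positive
      coefficient; if \<open>p * \<kappa> = g\<close>, these two cancel exactly and \<open>b\<close> comes next.\<close>
    note exps = inner_exponents[OF w1 w2 pr(1) S' b]
    have b2c: "b < 2 * c" using exps(1) c by simp
    have gc: "g < 2 * c" using c g w1 pr by simp
    have c2r: "2 * c < r" using c w2 pr by simp
    have cr: "r * \<kappa> = c" using 3 by simp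
    \<comment> \<open>\<open>V s\<close> is what the shift \<open>\<epsilon>\<close> adds to
      \<open>Q s\<close>. Its exponent \<open>s * \<kappa> + c\<close> is at least
      \<open>2 * c\<close> for \<open>s = r\<close> and \<open>s = p\<close>, beyond
      \<open>b\<close> and \<open>g\<close>, so it never enters the remaining comparisons.\<close>
    define V where "V s t = Q s t - ell (s * \<kappa> * t)" for s t
    have \<epsilon>c: "lead \<epsilon> c 0 ((0 - 1 / (c + g)) / 2)"
      unfolding \<epsilon>_def using 3 by (intro lead_divide lead_diff Af C)
    have V: "lead (V s) m 0 0" if "0 < s" "m < s * \<kappa> + c" for s m
      unfolding V_def Q_def using lead_faster[OF lead_ell_diff[OF \<epsilon>c cg(2) that(1) \<kappa>(1)] that(2)] .
    define H where "H t = p * rem a (- b) t - V r t - ell (g * t) + Q p t - ell (p * t) + ell (r * t)" for t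
    have H: "eventually (\<lambda>t. H t = 0) at_top"
      using F eventually_ge_at_top[of 0]
    proof eventually_elim
      case (elim t)
      have "r * rem c d t = ell (c * t) - ell (g * t)"
        using rem_eq_ell[of c d t] elim cg r by simp
      with elim(1) show ?case by (simp add: H_def V_def cr)
    qed
    have lead_H: "p * x - z + y = 0"
      if "lead (rem a (- b)) m 0 x" "lead (\<lambda>t. ell (g * t)) m 0 z" "lead (Q p) m 0 y" "0 < m" "m < 2 * c" for m x y z
    proof -
      have "lead H m 0 (p * x - 0 - z + y - 0 + 0)"
        unfolding H_def using that pr c2r cr by (intro lead_add lead_diff lead_cmult rest V that) auto
      from lead_eq_0[OF this H] show ?thesis by simp
    qed
    have "p * \<kappa> \<le> g \<and> p * \<kappa> \<le> b"
    proof (rule ccontr)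
      assume n: "\<not> ?thesis"
      define m where "m = min g b"
      have m: "m \<le> g" "m \<le> b" "0 < m" "m < 2 * c" "m = g \<or> m = b" "m < p * \<kappa>"
        using n cg ab gc b2c by (auto simp: m_def)
      obtain x where x: "lead (\<lambda>t. ell (g * t)) m 0 x" "0 \<le> x" "m = g \<Longrightarrow> x = 1"
        using lead_ell[of g] rest[of m g 0] m by (cases "m = g") fastforce+
      obtain y where y: "lead (rem a (- b)) m 0 (- y)" "0 \<le> y" "m = b \<Longrightarrow> y = 1 / (a + b)"
      proof (cases "m = b")
        case True then show ?thesis using that[of "1 / (a + b)"] A ab by simp
      next
        case False then show ?thesis using that[of 0] Af[of m 0] m by simp
      qed
      have "p * - y - x + 0 = 0" using m pr by (intro lead_H[OF y(1) x(1) Qf]) auto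
      moreover have "0 \<le> p * y" using pr y by simp
      ultimately have "p * y = 0" "x = 0" using x by linarith+
      with x y m pr ab show False by auto
    qed
    then have pg: "p * \<kappa> \<le> g" by simp
    with exps(2) g \<kappa>w have pb: "p * \<kappa> < b" by simp
    have pk0: "0 < p * \<kappa>" using pr \<kappa> by simp
    have "p * \<kappa> = g"
    proof (rule ccontr)
      assume "p * \<kappa> \<noteq> g"
      with pg have "p * \<kappa> < g" by simp
      then have "p * 0 - 0 + 1 = 0"
        using pb pk0 b2c pr by (intro lead_H[OF Af rest Q]) auto
      then show False by simp
    qed
    then have gb: "g < b" using pb by simp
    define H' where "H' t = p * rem a (- b) t - V r t + V p t - ell (p * t) + ell (r * t)" for t
    have "lead H' b 0 (p * - (1 / (a + b)) - 0 + 0 - 0 + 0)"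
      unfolding H'_def using ab pr c2r b2c cr \<open>p * \<kappa> = g\<close> r
      by (intro lead_add lead_diff lead_cmult rest V A) auto
    moreover have "H' t = H t" for t by (simp add: H'_def H_def V_def \<open>p * \<kappa> = g\<close>)
    ultimately show False using lead_eq_0[of H' b 0] H cpos by fastforce
  qed
qed

subsection \<open>The solutions\<close>

definition gini_solution :: "real \<Rightarrow> real \<Rightarrow> real \<Rightarrow> real \<Rightarrow> real \<Rightarrow> real \<Rightarrow> bool" where
  "gini_solution a b c d p q \<longleftrightarrow>
      (a + b = 0 \<and> c + d = 0 \<and> p + q = 0)
    \<or> ({a, b} = {c, d} \<and> {c, d} = {p, q})
    \<or> ({a, b} = {- c, - d} \<and> p + q = 0)
    \<or> (\<exists>u v. {a, b} = {u + v, v} \<and> {c, d} = {u - v, - v} \<and> {p, q} = {u, 0})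
    \<or> (\<exists>w. {a, b} = {3 * w, w} \<and> c + d = 0 \<and> {p, q} = {2 * w, 0})
    \<or> (\<exists>w. a + b = 0 \<and> {c, d} = {3 * w, w} \<and> {p, q} = {2 * w, 0})"

lemma gini_solution_commute:
  "gini_solution b a c d p q = gini_solution a b c d p q"
  "gini_solution a b d c p q = gini_solution a b c d p q"
  "gini_solution a b c d q p = gini_solution a b c d p q"
  by (simp_all add: gini_solution_def insert_commute[of b a] insert_commute[of d c] insert_commute[of q p]
      insert_commute[of "- d" "- c"] add.commute[of b a] add.commute[of d c] add.commute[of q p])

lemma gini_solutionI:
  "a + b = 0 \<Longrightarrow> c + d = 0 \<Longrightarrow> p + q = 0 \<Longrightarrow> gini_solution a b c d p q"
  "{a, b} = {c, d} \<Longrightarrow> {c, d} = {p, q} \<Longrightarrow> gini_solution a b c d p q"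
  "{a, b} = {- c, - d} \<Longrightarrow> p + q = 0 \<Longrightarrow> gini_solution a b c d p q"
  "{a, b} = {u + v, v} \<Longrightarrow> {c, d} = {u - v, - v} \<Longrightarrow> {p, q} = {u, 0} \<Longrightarrow> gini_solution a b c d p q"
  "{a, b} = {3 * w, w} \<Longrightarrow> c + d = 0 \<Longrightarrow> {p, q} = {2 * w, 0} \<Longrightarrow> gini_solution a b c d p q"
  "a + b = 0 \<Longrightarrow> {c, d} = {3 * w, w} \<Longrightarrow> {p, q} = {2 * w, 0} \<Longrightarrow> gini_solution a b c d p q"
  unfolding gini_solution_def
  by (rule disjI1, (intro conjI; assumption))
    (rule disjI2, rule disjI1, (intro conjI; assumption),
     rule disjI2, rule disjI2, rule disjI1, (intro conjI; assumption),
     rule disjI2, rule disjI2, rule disjI2, rule disjI1, (intro exI conjI; assumption),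
     rule disjI2, rule disjI2, rule disjI2, rule disjI2, rule disjI1, (intro exI conjI; assumption),
     rule disjI2, rule disjI2, rule disjI2, rule disjI2, rule disjI2, (intro exI conjI; assumption))

lemma gini_solutionE:
  assumes "gini_solution a b c d p q"
    and "a + b = 0 \<Longrightarrow> c + d = 0 \<Longrightarrow> p + q = 0 \<Longrightarrow> thesis"
    and "{a, b} = {c, d} \<Longrightarrow> {c, d} = {p, q} \<Longrightarrow> thesis"
    and "{a, b} = {- c, - d} \<Longrightarrow> p + q = 0 \<Longrightarrow> thesis"
    and "\<And>u v. {a, b} = {u + v, v} \<Longrightarrow> {c, d} = {u - v, - v} \<Longrightarrow> {p, q} = {u, 0} \<Longrightarrow> thesis"
    and "\<And>w. {a, b} = {3 * w, w} \<Longrightarrow> c + d = 0 \<Longrightarrow> {p, q} = {2 * w, 0} \<Longrightarrow> thesis"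
    and "\<And>w. a + b = 0 \<Longrightarrow> {c, d} = {3 * w, w} \<Longrightarrow> {p, q} = {2 * w, 0} \<Longrightarrow> thesis"
  shows thesis
  using assms(1) unfolding gini_solution_def
  by (elim disjE exE conjE) (rule assms(2-); assumption)+

lemma doubleton_minus: "{- a, - b} = {- x, - y} \<longleftrightarrow> {a, b} = {x, y :: real}"
  by (auto simp: doubleton_eq_iff)

lemma gini_solution_swap:
  assumes "gini_solution a b c d p q" shows "gini_solution c d a b p q"
  using assms
proof (rule gini_solutionE)
  assume "{a, b} = {- c, - d}" "p + q = 0"
  then show ?thesis using doubleton_minus[of a b "- c" "- d"] by (intro gini_solutionI(3)) simp_all
next
  fix u v assume "{a, b} = {u + v, v}" "{c, d} = {u - v, - v}" "{p, q} = {u, 0}"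
  then show ?thesis by (intro gini_solutionI(4)[of c d u "- v"]) simp_all
qed (simp_all add: gini_solutionI)

lemma gini_solution_minus:
  assumes "gini_solution (- a) (- b) (- c) (- d) (- p) (- q)"
  shows "gini_solution a b c d p q"
proof -
  have neg: "{x, y} = {z, w} \<longleftrightarrow> {- x, - y} = {- z, - w}" for x y z w :: real
    by (rule doubleton_minus[symmetric])
  from assms show ?thesis
  proof (rule gini_solutionE)
    assume "- a + - b = 0" "- c + - d = 0" "- p + - q = 0"
    then show ?thesis by (intro gini_solutionI(1)) simp_all
  next
    assume "{- a, - b} = {- c, - d}" "{- c, - d} = {- p, - q}"
    then show ?thesis by (intro gini_solutionI(2)) (simp_all only: doubleton_minus)
  next
    assume "{- a, - b} = {- (- c), - (- d)}" "- p + - q = 0"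
    then show ?thesis by (intro gini_solutionI(3)) (simp_all only: doubleton_minus)
  next
    fix u v assume "{- a, - b} = {u + v, v}" "{- c, - d} = {u - v, - v}" "{- p, - q} = {u, 0}"
    then show ?thesis by (intro gini_solutionI(4)[of a b "- u" "- v"]) (simp_all add: neg[of a] neg[of c] neg[of p] add.commute)
  next
    fix w assume "{- a, - b} = {3 * w, w}" "- c + - d = 0" "{- p, - q} = {2 * w, 0}"
    then show ?thesis by (intro gini_solutionI(5)[of a b "- w"]) (simp_all add: neg[of a] neg[of p])
  next
    fix w assume "- a + - b = 0" "{- c, - d} = {3 * w, w}" "{- p, - q} = {2 * w, 0}"
    then show ?thesis by (intro gini_solutionI(6)[of a b c d "- w"]) (simp_all add: neg[of c] neg[of p])
  qed
qed

section \<open>Necessity: from the slope relation to the list\<close>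

lemma slope_eq_1D: "b \<le> a \<Longrightarrow> slope a b = 1 \<Longrightarrow> 0 \<le> b \<and> 0 < a"
  by (rule slope_cases[of b a]) auto

lemma slope_eq_m1D: "b \<le> a \<Longrightarrow> slope a b = - 1 \<Longrightarrow> a \<le> 0 \<and> b < 0"
  by (rule slope_cases[of b a]) auto

lemma slope_innerD: "b \<le> a \<Longrightarrow> - 1 < slope a b \<Longrightarrow> slope a b < 1 \<Longrightarrow> a + b = 0 \<or> b < 0 \<and> 0 < a"
  by (rule slope_cases[of b a]) auto

lemma slope_bounds: "b \<le> a \<Longrightarrow> - 1 \<le> slope a b \<and> slope a b \<le> 1"
  by (rule slope_cases[of b a]) auto

lemma slope_inner_posD:
  "b \<le> a \<Longrightarrow> 0 < slope a b \<Longrightarrow> slope a b < 1 \<Longrightarrow> b < 0 \<and> 0 < a \<and> - b < a"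
  using slope_innerD[of b a] slope_opposite[of a b] slope_mixed[of b a]
  by (auto simp: zero_less_divide_iff)

lemma slope_eq_0D: "b \<le> a \<Longrightarrow> slope a b = 0 \<Longrightarrow> a + b = 0"
  using slope_innerD[of b a] slope_mixed[of b a] by auto

text \<open>The slope relation says that \<open>k\<close> is the mean of \<open>k1\<close> and
  \<open>k2\<close> with weights \<open>(1 + k) / 2\<close> and \<open>(1 - k) / 2\<close>. Hence
  \<open>k1 = 1\<close> with an inner \<open>k2\<close> forces \<open>k = 1\<close>, and
  \<open>k1 < 1\<close> with \<open>k2 < k1\<close> forces all three slopes to be inner.\<close>

lemma log_invariant_imp_solution_aux:
  assumes inv: "log_invariant a b c d p q" and le: "b \<le> a" "d \<le> c" "q \<le> p"
    and sl: "slope c d \<le> slope a b" and k: "0 \<le> slope p q"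
  shows "gini_solution a b c d p q"
proof -
  define k1 k2 k where "k1 = slope a b" and "k2 = slope c d" and "k = slope p q"
  have eq: "(k1 + k2) / 2 + k * ((k1 - k2) / 2) = k"
    using log_invariant_slope[OF inv sl] by (simp add: k1_def k2_def k_def)
  have bnd: "- 1 \<le> k1" "k1 \<le> 1" "- 1 \<le> k2" "k2 \<le> 1" "0 \<le> k" "k \<le> 1"
    using slope_bounds le k by (auto simp: k1_def k2_def k_def)
  have sum: "a + b + c + d = 2 * (p + q)" by (rule log_invariant_sum[OF inv])
  consider "k1 = k2" | "k2 < k1" "k1 = 1" "k2 = - 1" | "k2 < k1" "k1 = 1" "- 1 < k2"
    | "k2 < k1" "k1 < 1" using sl bnd unfolding k1_def[symmetric] k2_def[symmetric] by linarith
  then show ?thesis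
  proof cases
    case 1
    with eq have kk: "k1 = k" "k2 = k" by simp_all
    consider "k = 1" | "k = 0" | "0 < k" "k < 1" using bnd by linarith
    then show ?thesis
    proof cases
      case 1
      then have "a = p \<and> b = q \<and> c = p \<and> d = q"
        using kk slope_eq_1D[OF le(1)] slope_eq_1D[OF le(2)] slope_eq_1D[OF le(3)] le
        by (intro equal_slopes_one[OF inv]) (simp_all add: k1_def k2_def k_def)
      then show ?thesis by (intro gini_solutionI(2)) simp_all
    next
      case 2
      then show ?thesis
        using kk slope_eq_0D[OF le(1)] slope_eq_0D[OF le(2)] slope_eq_0D[OF le(3)]
        by (intro gini_solutionI(1)) (simp_all add: k1_def k2_def k_def)
    next
      case 3
      then have "a = p \<and> b = q \<and> c = p \<and> d = q"
        using kk slope_inner_posD[OF le(1)] slope_inner_posD[OF le(2)] slope_inner_posD[OF le(3)]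
        by (intro equal_slopes_mixed[OF inv, where k = k]) (simp_all add: k1_def k2_def k_def)
      then show ?thesis by (intro gini_solutionI(2)) simp_all
    qed
  next
    case 2
    have ab: "0 \<le> b" "0 < a" and cd: "0 \<le> - c" "- c \<le> - d" "0 < - d"
      using slope_eq_1D[OF le(1)] slope_eq_m1D[OF le(2)] 2 le by (auto simp: k1_def k2_def)
    have inv': "log_invariant a b (- (- c)) (- (- d)) p q" using inv by simp
    consider "k = 0" | "0 < k" "k < 1" | "k = 1" "0 < q" | "k = 1" "q = 0"
      using bnd slope_eq_1D[OF le(3)] unfolding k_def by linarith
    then show ?thesis
    proof cases
      case 1
      then have pq: "p + q = 0" using slope_eq_0D[OF le(3)] by (simp add: k_def)
      have "a = - d \<and> b = - c" by (rule opposite_slopes_geometric[OF inv' pq ab(1) le(1) ab(2) cd])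
      with pq show ?thesis by (intro gini_solutionI(3)) (simp_all add: insert_commute)
    next
      case 2
      then have pq: "q < 0" "0 < p" "- q < p" using slope_inner_posD[OF le(3)] by (auto simp: k_def)
      with opposite_slopes_mixed[of a b "- c" "- d" p "- q"] inv' ab le cd show ?thesis by simp
    next
      case 3
      with opposite_slopes_one[OF inv' ab(1) le(1) ab(2) cd _ le(3)] show ?thesis by simp
    next
      case 4
      then have "0 < p" using slope_eq_1D[OF le(3)] by (simp add: k_def)
      with opposite_slopes_power[of a b "- c" "- d" p] inv' 4 ab le cd
      have "a = p + - d \<and> b = p + - c \<and> - d = p + - c" by simp
      then show ?thesis using 4 by (intro gini_solutionI(4)[of a b p "- d"]) auto
    qed
  next
    case 3
    have ab: "0 \<le> b" "0 < a" using slope_eq_1D[OF le(1)] 3 by (auto simp: k1_def)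
    have cd: "c + d = 0 \<or> d < 0 \<and> 0 < c" "- 1 < slope c d" "slope c d < 1"
      using slope_innerD[OF le(2)] 3 by (auto simp: k2_def)
    have "(1 + k2) * (k - 1) = 0" using eq unfolding 3(2) by (simp add: field_simps)
    then have "k = 1" using 3 by simp
    then have pq: "0 \<le> q" "0 < p" using slope_eq_1D[OF le(3)] by (auto simp: k_def)
    have "q = 0"
      using one_extremal_slope_pos[OF inv ab(1) le(1) ab(2) _ le(3) cd] pq by force
    with one_extremal_slope_power[of a b c d p] inv ab le pq cd
    consider "c + d = 0" "p = 2 * b" "a = 3 * b" | "a = p + b" "c = p - b" "d = - b" by auto
    then show ?thesis
    proof cases
      case 1
      then show ?thesis using \<open>q = 0\<close> by (intro gini_solutionI(5)[of a b b]) simp_all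
    next
      case 2
      then show ?thesis using \<open>q = 0\<close> by (intro gini_solutionI(4)[of a b p b]) simp_all
    qed
  next
    case 4
    have k2: "- 1 < k2"
    proof (rule ccontr)
      assume "\<not> - 1 < k2"
      with bnd have "k2 = - 1" by simp
      with eq have "(1 - k1) * (1 + k) = 0" by (simp add: field_simps)
      with 4 bnd show False by simp
    qed
    have cd: "c + d = 0 \<or> d < 0 \<and> 0 < c" using slope_innerD[OF le(2)] 4 k2 by (simp add: k1_def k2_def)
    have "k \<noteq> 1"
    proof
      assume "k = 1"
      with eq have "k1 = 1" by (simp add: field_simps)
      with 4 show False by simp
    qed
    with bnd have k1': "k < 1" by simp
    show ?thesis
    proof (cases "k = 0")
      case True
      then have pq: "p + q = 0" using slope_eq_0D[OF le(3)] by (simp add: k_def)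
      have k12: "k2 = - k1" "0 < k1" using eq True 4 by simp_all
      then have ab: "b < 0" "0 < a" "- b < a" using slope_inner_posD[OF le(1)] 4 by (auto simp: k1_def)
      have "c + d \<noteq> 0" using k12 slope_opposite[of c d] by (auto simp: k2_def)
      with cd have cd': "d < 0" "0 < c" by auto
      \<comment> \<open>With \<open>p + q = 0\<close> both the slopes and the sums of the two pairs
        are opposite. The differences therefore agree, and the pairs are negatives of each other
        without any further asymptotics.\<close>
      have "(c + d) / (c - d) = - ((a + b) / (a - b))"
        using k12 slope_mixed[OF ab(1,2)] slope_mixed[OF cd'] by (simp add: k1_def k2_def)
      moreover have s: "c + d = - (a + b)" using sum pq by simp
      ultimately have "- (a + b) / (c - d) = - (a + b) / (a - b)" by (simp only: minus_divide_left)
      then have "(a + b) / (c - d) = (a + b) / (a - b)"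
        by (simp only: minus_divide_left[symmetric] neg_equal_iff_equal)
      then have "(a + b) * (a - b) = (a + b) * (c - d)" using ab cd' by (subst (asm) frac_eq_eq) auto
      then have "a - b = c - d" using ab by simp
      with s have "a = - d" "b = - c" by simp_all
      with pq show ?thesis by (intro gini_solutionI(3)) (simp_all add: insert_commute)
    next
      case False
      with bnd have kpos: "0 < k" by simp
      have pq: "q < 0" "0 < p" "- q < p" using slope_inner_posD[OF le(3)] kpos k1' by (auto simp: k_def)
      have "k1 + k2 = k * (2 - (k1 - k2))" using eq by (simp add: field_simps)
      also have "\<dots> > 0" using kpos 4 k2 by (intro mult_pos_pos) auto
      finally have "0 < k1" using 4 by simp
      then have ab: "b < 0" "0 < a" "- b < a" using slope_inner_posD[OF le(1)] 4 by (auto simp: k1_def)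
      have "log_invariant a (- (- b)) c d p (- (- q))" using inv by simp
      then have False
        by (rule inner_slopes_contradiction) (use ab pq cd 4 k2 in \<open>simp_all add: k1_def k2_def\<close>)
      then show ?thesis ..
    qed
  qed
qed

text \<open>Negating all parameters makes \<open>slope p q\<close> positive but reverses the order
  of the other two slopes; exchanging the two inner means restores it.\<close>

lemma log_invariant_imp_solution_ordered:
  assumes inv: "log_invariant a b c d p q" and le: "b \<le> a" "d \<le> c" "q \<le> p"
    and sl: "slope c d \<le> slope a b"
  shows "gini_solution a b c d p q"
proof (cases "0 \<le> slope p q")
  case True
  then show ?thesis using log_invariant_imp_solution_aux assms by blast
next
  case False
  have "log_invariant (- d) (- c) (- b) (- a) (- q) (- p)"
    using log_invariant_swap[OF log_invariant_minus[OF inv]] by (simp add: log_invariant_commute)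
  then have "gini_solution (- d) (- c) (- b) (- a) (- q) (- p)"
    by (rule log_invariant_imp_solution_aux)
      (use le sl False in \<open>simp_all add: slope_minus slope_commute[of d] slope_commute[of b] slope_commute[of q]\<close>)
  then have "gini_solution (- a) (- b) (- c) (- d) (- p) (- q)"
    using gini_solution_swap by (simp add: gini_solution_commute)
  then show ?thesis by (rule gini_solution_minus)
qed

lemma log_invariant_imp_solution:
  assumes inv: "log_invariant a b c d p q"
  shows "gini_solution a b c d p q"
proof -
  have 1: "gini_solution a b c d p q" if "log_invariant a b c d p q" "b \<le> a" "d \<le> c" "q \<le> p" for a b c d p q
  proof (cases "slope c d \<le> slope a b")
    case True with that log_invariant_imp_solution_ordered show ?thesis by blast
  next
    case False
    then show ?thesis
      using log_invariant_imp_solution_ordered[OF log_invariant_swap[OF that(1)]] that gini_solution_swap by simp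
  qed
  have 2: "gini_solution a b c d p q" if "log_invariant a b c d p q" "b \<le> a" "d \<le> c" for a b c d p q
    using 1[of a b c d p q] 1[of a b c d q p] that by (cases "q \<le> p") (auto simp: log_invariant_commute gini_solution_commute)
  have 3: "gini_solution a b c d p q" if "log_invariant a b c d p q" "b \<le> a" for a b c d p q
    using 2[of a b c d p q] 2[of a b d c p q] that by (cases "d \<le> c") (auto simp: log_invariant_commute gini_solution_commute)
  show ?thesis
    using 3[of a b c d p q] 3[of b a c d p q] inv by (cases "b \<le> a") (auto simp: log_invariant_commute gini_solution_commute)
qed

section \<open>Sufficiency and the identification of the means\<close>

lemma log_gini_doubleton: "{a, b} = {c, d} \<Longrightarrow> log_gini a b t = log_gini c d t"
  by (auto simp: doubleton_eq_iff intro: log_gini_commute)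

lemma gini_mean_doubleton: "{a, b} = {c, d} \<Longrightarrow> mean_eq (gini_mean a b) (gini_mean c d)"
  unfolding mean_eq_def by (metis gini_mean_exp log_gini_doubleton pos_pair_exp)

lemma gini_mean_geometric: "p + q = 0 \<Longrightarrow> mean_eq (gini_mean p q) geometric_mean"
proof -
  assume pq: "p + q = 0"
  have "gini_mean p q x y = geometric_mean x y" if xy: "x > 0" "y > 0" for x y
  proof -
    obtain m t where mt: "x = exp (m + t)" "y = exp (m - t)" using pos_pair_exp[OF xy] .
    have "x * y = exp m * exp m" by (simp add: mt flip: exp_add)
    then have "geometric_mean x y = exp m" by (simp add: geometric_mean_def)
    then show ?thesis using pq by (simp add: mt gini_mean_exp log_gini_opposite)
  qed
  then show ?thesis by (simp add: mean_eq_def)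
qed

text \<open>The \<open>u\<close>-th powers of the inner means are quotients with common denominator
  \<open>cosh (v * t)\<close>, and the addition theorem sums their numerators to
  \<open>2 * cosh (u * t) * cosh (v * t)\<close>.\<close>

lemma log_invariant_power_family: "log_invariant (u + v) v (u - v) (- v) u 0"
proof (cases "u = 0")
  case True
  then show ?thesis
    using log_gini_minus[of v v] by (simp add: log_invariant_def log_gini_opposite)
next
  case False
  have "exp (u * log_gini (u + v) v t) + exp (u * log_gini (u - v) (- v) t) = 2 * cosh (u * t)" for t
  proof -
    have "exp (u * log_gini (u + v) v t) = cosh (u * t + v * t) / cosh (v * t)"
      "exp (u * log_gini (u - v) (- v) t) = cosh (u * t - v * t) / cosh (v * t)"
      using False by (simp_all add: log_gini_def exp_diff distrib_right left_diff_distrib)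
    then show ?thesis by (simp add: cosh_add cosh_diff flip: add_divide_distrib)
  qed
  then show ?thesis using False by (simp add: log_invariant_power_iff)
qed

text \<open>By the triple angle formula \<open>cosh (3 * x) / cosh x = 2 * cosh (2 * x) - 1\<close>,
  and the geometric mean contributes the missing 1.\<close>

lemma log_invariant_triple_family:
  assumes "c + d = 0" shows "log_invariant (3 * w) w c d (2 * w) 0"
proof (cases "w = 0")
  case True
  then show ?thesis using assms by (simp add: log_invariant_def log_gini_opposite)
next
  case False
  have "exp (2 * w * log_gini (3 * w) w t) + exp (2 * w * log_gini c d t) = 2 * cosh (2 * w * t)" for t
  proof -
    have "exp (2 * w * log_gini (3 * w) w t) = cosh (3 * w * t) / cosh (w * t)"
      using False by (simp add: log_gini_def exp_diff)
    also have "3 * w * t = 2 * (w * t) + w * t" by simp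
    also have "cosh (2 * (w * t) + w * t) = (2 * cosh (2 * (w * t)) - 1) * cosh (w * t)"
    proof -
      have "cosh (2 * x + x) = (2 * cosh (2 * x) - 1) * cosh x" for x :: real
        using cosh_add[of "2 * x" x] cosh_diff[of "2 * x" x] by (simp add: algebra_simps)
      then show ?thesis .
    qed
    finally show ?thesis using assms by (simp add: log_gini_opposite mult.assoc)
  qed
  then show ?thesis using False by (subst log_invariant_power_iff) auto
qed

lemma log_invariant_doubleton:
  assumes "{a, b} = {a', b'}" "{c, d} = {c', d'}" "{p, q} = {p', q'}"
  shows "log_invariant a b c d p q = log_invariant a' b' c' d' p' q'"
  using log_gini_doubleton[OF assms(1)] log_gini_doubleton[OF assms(2)] log_gini_doubleton[OF assms(3)]
  by (simp add: log_invariant_def)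

lemma solution_imp_log_invariant:
  assumes "gini_solution a b c d p q" shows "log_invariant a b c d p q"
  using assms
proof (rule gini_solutionE)
  assume "a + b = 0" "c + d = 0" "p + q = 0"
  then show ?thesis by (simp add: log_invariant_def log_gini_opposite)
next
  assume "{a, b} = {c, d}" "{c, d} = {p, q}"
  then show ?thesis using log_gini_doubleton[of a b p q] log_gini_doubleton[of c d p q]
    by (simp add: log_invariant_def)
next
  assume "{a, b} = {- c, - d}" "p + q = 0"
  then show ?thesis using log_gini_doubleton[of a b "- c" "- d"]
    by (simp add: log_invariant_def log_gini_opposite log_gini_minus)
next
  fix u v assume "{a, b} = {u + v, v}" "{c, d} = {u - v, - v}" "{p, q} = {u, 0}"
  from log_invariant_doubleton[OF this] log_invariant_power_family show ?thesis by simp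
next
  fix w assume "{a, b} = {3 * w, w}" "c + d = 0" "{p, q} = {2 * w, 0}"
  from log_invariant_doubleton[OF this(1) refl this(3)] log_invariant_triple_family[OF this(2)]
  show ?thesis by simp
next
  fix w assume "a + b = 0" "{c, d} = {3 * w, w}" "{p, q} = {2 * w, 0}"
  from log_invariant_doubleton[OF refl this(2,3)] log_invariant_swap[OF log_invariant_triple_family[OF this(1)]]
  show ?thesis by simp
qed

lemma gini_mean_power: "{p, q} = {r, 0} \<Longrightarrow> mean_eq (gini_mean p q) (power_mean r)"
  unfolding power_mean_def by (rule gini_mean_doubleton)

theorem mainTheorem1:
  fixes a b c d p q :: real
  shows "((\<forall>x>0. \<forall>y>0.
             gini_mean p q (gini_mean a b x y) (gini_mean c d x y) = gini_mean p q x y)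
          \<longleftrightarrow>
            (a + b = 0 \<and> c + d = 0 \<and> p + q = 0)
          \<or> ({a, b} = {c, d} \<and> {c, d} = {p, q})
          \<or> ({a, b} = {- c, - d} \<and> p + q = 0)
          \<or> (\<exists>u v. {a, b} = {u + v, v} \<and> {c, d} = {u - v, - v} \<and> {p, q} = {u, 0})
          \<or> (\<exists>w. {a, b} = {3 * w, w} \<and> c + d = 0 \<and> {p, q} = {2 * w, 0})
          \<or> (\<exists>w. a + b = 0 \<and> {c, d} = {3 * w, w} \<and> {p, q} = {2 * w, 0}))
       \<and> (a + b = 0 \<and> c + d = 0 \<and> p + q = 0 \<longrightarrow>
            mean_eq (gini_mean a b) geometric_mean \<and> mean_eq (gini_mean c d) geometric_mean
            \<and> mean_eq (gini_mean p q) geometric_mean)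
       \<and> ({a, b} = {c, d} \<and> {c, d} = {p, q} \<longrightarrow>
            mean_eq (gini_mean a b) (gini_mean c d) \<and> mean_eq (gini_mean c d) (gini_mean p q))
       \<and> ({a, b} = {- c, - d} \<and> p + q = 0 \<longrightarrow>
            mean_eq (gini_mean p q) geometric_mean
            \<and> mean_eq (gini_mean a b) (gini_mean (- c) (- d)))
       \<and> ((\<exists>u v. {a, b} = {u + v, v} \<and> {c, d} = {u - v, - v} \<and> {p, q} = {u, 0}) \<longrightarrow>
            (\<exists>r. mean_eq (gini_mean p q) (power_mean r)))
       \<and> ((\<exists>w. {a, b} = {3 * w, w} \<and> c + d = 0 \<and> {p, q} = {2 * w, 0}) \<longrightarrow>
            (\<exists>r. mean_eq (gini_mean p q) (power_mean r))
            \<and> mean_eq (gini_mean c d) geometric_mean)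
       \<and> ((\<exists>w. a + b = 0 \<and> {c, d} = {3 * w, w} \<and> {p, q} = {2 * w, 0}) \<longrightarrow>
            (\<exists>r. mean_eq (gini_mean p q) (power_mean r))
            \<and> mean_eq (gini_mean a b) geometric_mean)"
proof (intro conjI)
  show "(\<forall>x>0. \<forall>y>0.
             gini_mean p q (gini_mean a b x y) (gini_mean c d x y) = gini_mean p q x y)
          \<longleftrightarrow>
            (a + b = 0 \<and> c + d = 0 \<and> p + q = 0)
          \<or> ({a, b} = {c, d} \<and> {c, d} = {p, q})
          \<or> ({a, b} = {- c, - d} \<and> p + q = 0)
          \<or> (\<exists>u v. {a, b} = {u + v, v} \<and> {c, d} = {u - v, - v} \<and> {p, q} = {u, 0})
          \<or> (\<exists>w. {a, b} = {3 * w, w} \<and> c + d = 0 \<and> {p, q} = {2 * w, 0})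
          \<or> (\<exists>w. a + b = 0 \<and> {c, d} = {3 * w, w} \<and> {p, q} = {2 * w, 0})"
    unfolding invariance_iff gini_solution_def[symmetric]
    using log_invariant_imp_solution solution_imp_log_invariant by blast
next
  show "a + b = 0 \<and> c + d = 0 \<and> p + q = 0 \<longrightarrow>
      mean_eq (gini_mean a b) geometric_mean \<and> mean_eq (gini_mean c d) geometric_mean
      \<and> mean_eq (gini_mean p q) geometric_mean"
    by (simp add: gini_mean_geometric)
  show "{a, b} = {c, d} \<and> {c, d} = {p, q} \<longrightarrow>
      mean_eq (gini_mean a b) (gini_mean c d) \<and> mean_eq (gini_mean c d) (gini_mean p q)"
    by (intro impI conjI gini_mean_doubleton) auto
  show "{a, b} = {- c, - d} \<and> p + q = 0 \<longrightarrow>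
      mean_eq (gini_mean p q) geometric_mean \<and> mean_eq (gini_mean a b) (gini_mean (- c) (- d))"
    by (intro impI conjI gini_mean_doubleton gini_mean_geometric) auto
  show "(\<exists>u v. {a, b} = {u + v, v} \<and> {c, d} = {u - v, - v} \<and> {p, q} = {u, 0}) \<longrightarrow>
      (\<exists>r. mean_eq (gini_mean p q) (power_mean r))"
    by (metis gini_mean_power)
  show "(\<exists>w. {a, b} = {3 * w, w} \<and> c + d = 0 \<and> {p, q} = {2 * w, 0}) \<longrightarrow>
      (\<exists>r. mean_eq (gini_mean p q) (power_mean r)) \<and> mean_eq (gini_mean c d) geometric_mean"
    by (metis gini_mean_power gini_mean_geometric)
  show "(\<exists>w. a + b = 0 \<and> {c, d} = {3 * w, w} \<and> {p, q} = {2 * w, 0}) \<longrightarrow>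
      (\<exists>r. mean_eq (gini_mean p q) (power_mean r)) \<and> mean_eq (gini_mean a b) geometric_mean"
    by (metis gini_mean_power gini_mean_geometric)
qed

end
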